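(* Let $\mathbf{S}$ and $\mathbf{T}$ be two nondegenerate ordered set partitions of $[n]$. Then $\mathbf{S}$ and $\mathbf{T}$ are not compatible if and only if they are $4$-interlaced or $6$-interlaced. In particular, $\mathbf{S}$ and $\mathbf{T}$ are compatible if and only if $\mathbf{S}|_I$ and $\mathbf{T}|_I$ are compatible for every $I\subseteq[n]$ with $|I|\le 6$.
   Context: $\mathcal{H}_n=\{x\in\mathbb{R}^n:\sum x_i=0\}$. A polytope in $\mathcal{H}_n$ is alcoved if all its facet normal directions are parallel to roots $e_i-e_j$ (equivalently it is cut out in $\mathcal{H}_n$ by inequalities $x_i-x_j\le a_{i,j}$). An ordered set partition of $[n]$ is a tuple $\mathbf{S}=(B_1,\dots,B_\ell)$ of nonempty pairwise disjoint sets with union $[n]$; it is nondegenerate if every block is a singleton (so it is a cyclic order on $[n]$). Ordered set partitions are considered up to cyclic shifts of their blocks. The alcoved simplex $\Delta_{\mathbf{S}}\subseteq\mathcal{H}_n$ is defined by $x_i=x_j$ for $i,j$ in a common block, $x_i\ge x_j$ for $i\in B_k,j\in B_{k+1}$ ($1\le k\le\ell-1$), and $x_i\ge x_j-1$ for $i\in B_\ell,j\in B_1$. $\mathbf{S}$ and $\mathbf{T}$ are compatible if $\Delta_{\mathbf{S}}+\Delta_{\mathbf{T}}$ is alcoved. The restriction $\mathbf{S}|_I$ to $I\subseteq[n]$ is obtained by intersecting blocks with $I$ and deleting empty ones. $\mathbf{S},\mathbf{T}$ are $4$-interlaced if there exist distinct $a,b,c,d\in[n]$ with $\mathbf{S}|_{\{a,b,c,d\}}=(a,b,c,d)$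 and $\mathbf{T}|_{\{a,b,c,d\}}=(c,b,a,d)$. They are $6$-interlaced if there exist distinct $a,b,c,d,e,f\in[n]$ with $\mathbf{S}|_{\{a,\dots,f\}}=(a,b,c,d,e,f)$ and either $\mathbf{T}|_{\{a,\dots,f\}}=(c,d,a,b,e,f)$ or $\mathbf{T}|_{\{a,\dots,f\}}=(a,d,e,b,c,f)$ (equalities up to cyclic shift). *)

theory Defs
  imports "HOL-Analysis.Analysis"
begin

text \<open>
  The ground set \<open>[n]\<close> is a finite type \<open>'n\<close>.  Restrictions live on subsets \<open>A\<close> of the
  ground set, so everything is relative to such an \<open>A\<close>: the space \<open>\<real>\<^sup>A\<close> is identified with the
  coordinate subspace of \<open>real ^ 'n\<close> of vectors that vanish outside \<open>A\<close>.
\<close>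

definition sum_zero_space :: "'n::finite set \<Rightarrow> (real ^ 'n) set" where
  "sum_zero_space A = {x. (\<forall>i. i \<notin> A \<longrightarrow> x $ i = 0) \<and> (\<Sum>i\<in>A. x $ i) = 0}"

text \<open>
  Being cut out by root inequalities also makes sense for polytopes that are not
  full-dimensional.  For full-dimensional ones it is the condition that all facet normals are
  parallel to roots: see \<open>alcoved_iff_facets_root_normal\<close> below, and
  \<open>compatible_iff_facets_root_normal\<close> for the polytopes relevant to nondegenerate partitions.
\<close>

definition alcoved :: "'n::finite set \<Rightarrow> (real ^ 'n) set \<Rightarrow> bool" where
  "alcoved A P \<longleftrightarrow> polytope P \<and>
     (\<exists>a :: 'n \<Rightarrow> 'n \<Rightarrow> real.
        P = {x \<in> sum_zero_space A. \<forall>i\<in>A. \<forall>j\<in>A. i \<noteq> j \<longrightarrow> x $ i - x $ j \<le> a i j})"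

definition facets_root_normal :: "'n::finite set \<Rightarrow> (real ^ 'n) set \<Rightarrow> bool" where
  "facets_root_normal A P \<longleftrightarrow>
     (\<forall>F. F facet_of P \<longrightarrow>
        (\<exists>i\<in>A. \<exists>j\<in>A. \<exists>c. i \<noteq> j \<and> P \<subseteq> {x. x $ i - x $ j \<le> c} \<and>
           F = P \<inter> {x. x $ i - x $ j = c}))"

text \<open>
  Ordered set partitions are represented by lists of blocks.  A cyclic shift of the blocks
  translates \<open>alcoved_simplex A S\<close>, hence \<open>compatible\<close> does not depend on the representative;
  equality of restrictions up to cyclic shifts is expressed by \<open>cyclic_eq\<close>.
\<close>

definition ordered_set_partition :: "'a set \<Rightarrow> 'a set list \<Rightarrow> bool" where
  "ordered_set_partition A S \<longleftrightarrow> {} \<notin> set S \<and> \<Union> (set S) = A \<and>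
     (\<forall>k < length S. \<forall>l < length S. k \<noteq> l \<longrightarrow> S ! k \<inter> S ! l = {})"

definition nondegenerate :: "'a set list \<Rightarrow> bool" where
  "nondegenerate S \<longleftrightarrow> (\<forall>B \<in> set S. is_singleton B)"

definition cyclic_eq :: "'a list \<Rightarrow> 'a list \<Rightarrow> bool" where
  "cyclic_eq xs ys \<longleftrightarrow> (\<exists>k. rotate k xs = ys)"

definition osp_restrict :: "'a set list \<Rightarrow> 'a set \<Rightarrow> 'a set list" where
  "osp_restrict S I = filter (\<lambda>B. B \<noteq> {}) (map (\<lambda>B. B \<inter> I) S)"

definition alcoved_simplex :: "'n::finite set \<Rightarrow> 'n set list \<Rightarrow> (real ^ 'n) set" where
  "alcoved_simplex A S = {x \<in> sum_zero_space A.
     (\<forall>B \<in> set S. \<forall>i\<in>B. \<forall>j\<in>B. x $ i = x $ j) \<and>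
     (\<forall>k. Suc k < length S \<longrightarrow> (\<forall>i \<in> S ! k. \<forall>j \<in> S ! Suc k. x $ i \<ge> x $ j)) \<and>
     (S \<noteq> [] \<longrightarrow> (\<forall>i \<in> last S. \<forall>j \<in> hd S. x $ i \<ge> x $ j - 1))}"

text \<open>The \<open>+\<close> is the Minkowski sum.\<close>

definition compatible :: "'n::finite set \<Rightarrow> 'n set list \<Rightarrow> 'n set list \<Rightarrow> bool" where
  "compatible A S T \<longleftrightarrow> alcoved A (alcoved_simplex A S + alcoved_simplex A T)"

definition four_interlaced :: "'a set list \<Rightarrow> 'a set list \<Rightarrow> bool" where
  "four_interlaced S T \<longleftrightarrow>
     (\<exists>a b c d. distinct [a, b, c, d] \<and>
        cyclic_eq (osp_restrict S {a, b, c, d}) [{a}, {b}, {c}, {d}] \<and>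
        cyclic_eq (osp_restrict T {a, b, c, d}) [{c}, {b}, {a}, {d}])"

definition six_interlaced :: "'a set list \<Rightarrow> 'a set list \<Rightarrow> bool" where
  "six_interlaced S T \<longleftrightarrow>
     (\<exists>a b c d e f. distinct [a, b, c, d, e, f] \<and>
        cyclic_eq (osp_restrict S {a, b, c, d, e, f}) [{a}, {b}, {c}, {d}, {e}, {f}] \<and>
        (cyclic_eq (osp_restrict T {a, b, c, d, e, f}) [{c}, {d}, {a}, {b}, {e}, {f}] \<or>
         cyclic_eq (osp_restrict T {a, b, c, d, e, f}) [{a}, {d}, {e}, {b}, {c}, {f}]))"

subsection \<open>Alcoved polytopes and facet normals\<close>

lemma subspace_sum_zero_space: "subspace (sum_zero_space A)"
  unfolding subspace_def sum_zero_space_def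
  by (auto simp: sum.distrib simp flip: sum_distrib_left)

lemma root_face_of:
  fixes P :: "(real ^ 'n::finite) set"
  assumes "convex P" "P \<subseteq> {x. x $ i - x $ j \<le> c}"
  shows "(P \<inter> {x. x $ i - x $ j = c}) face_of P"
proof -
  have eq: "x $ i - x $ j = (axis i 1 - axis j 1) \<bullet> x" for x :: "real ^ 'n"
    by (simp add: inner_diff_left inner_axis')
  show ?thesis
    unfolding eq
    by (rule face_of_Int_supporting_hyperplane_le) (use assms in \<open>auto simp: eq[symmetric]\<close>)
qed

lemma alcoved_imp_facets_root_normal:
  assumes P: "alcoved A P" and full: "affine hull P = sum_zero_space A"
  shows "facets_root_normal A P"
  unfolding facets_root_normal_def
proof (intro allI impI)
  fix F assume F: "F facet_of P"
  obtain a where a: "P = {x \<in> sum_zero_space A. \<forall>i\<in>A. \<forall>j\<in>A. i \<noteq> j \<longrightarrow> x $ i - x $ j \<le> a i j}"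
    and pol: "polytope P"
    using P unfolding alcoved_def by blast
  have cP: "convex P"
    using pol by (rule polytope_imp_convex)
  have Ff: "F face_of P" and Fne: "F \<noteq> {}" and dF: "aff_dim F = aff_dim P - 1"
    using F by (auto simp: facet_of_def)
  have cF: "convex F"
    using Ff by (rule face_of_imp_convex)
  obtain z where z: "z \<in> rel_interior F"
    using rel_interior_eq_empty[OF cF] Fne by blast
  have zF: "z \<in> F"
    using z rel_interior_subset by blast
  have zP: "z \<in> P"
    using zF Ff face_of_imp_subset by blast
  have FP: "F \<noteq> P"
    using dF by auto
  have "\<exists>i\<in>A. \<exists>j\<in>A. i \<noteq> j \<and> z $ i - z $ j = a i j"
  proof (rule ccontr)
    assume neg: "\<not> ?thesis"
    define U where "U = (\<Inter>(i, j) \<in> {(i, j). i \<in> A \<and> j \<in> A \<and> i \<noteq> j}.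
      {x :: real ^ 'a. x $ i - x $ j < a i j})"
    have "open U"
      unfolding U_def
      by (intro open_INT ballI finite) (auto intro!: open_Collect_less continuous_intros)
    moreover have "z \<in> U"
      using neg zP unfolding a U_def by (auto simp: less_le)
    moreover have "U \<inter> affine hull P \<subseteq> P"
      unfolding full by (subst a) (auto simp: U_def intro: less_imp_le)
    ultimately have "z \<in> rel_interior P"
      using zP unfolding mem_rel_interior by blast
    moreover have "F \<inter> rel_interior P = {}"
      using face_of_disjoint_rel_interior[OF Ff FP] .
    ultimately show False
      using zF by blast
  qed
  then obtain i j where ij: "i \<in> A" "j \<in> A" "i \<noteq> j" and zij: "z $ i - z $ j = a i j"
    by blast
  define G where "G = P \<inter> {x. x $ i - x $ j = a i j}"
  have sub: "P \<subseteq> {x. x $ i - x $ j \<le> a i j}"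
    using ij by (subst a) auto
  have Gf: "G face_of P"
    unfolding G_def by (rule root_face_of[OF cP sub])
  have FG: "F \<subseteq> G"
  proof (rule subset_of_face_of[OF Gf])
    show "F \<subseteq> P"
      using Ff by (rule face_of_imp_subset)
    show "G \<inter> rel_interior F \<noteq> {}"
      using z zP zij by (auto simp: G_def)
  qed
  have "G \<noteq> P"
  proof
    assume "G = P"
    have "affine {x :: real ^ 'a. x $ i - x $ j = a i j}"
    proof -
      have "x $ i - x $ j = (axis i 1 - axis j 1) \<bullet> x" for x :: "real ^ 'a"
        by (simp add: inner_diff_left inner_axis')
      then show ?thesis
        by (simp add: affine_hyperplane)
    qed
    then have hull: "sum_zero_space A \<subseteq> {x. x $ i - x $ j = a i j}"
      unfolding full[symmetric] using \<open>G = P\<close> by (intro hull_minimal) (auto simp: G_def)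
    have "0 \<in> sum_zero_space A"
      by (simp add: sum_zero_space_def)
    then have a0: "a i j = 0"
      using hull by auto
    have "axis i 1 - axis j 1 \<in> sum_zero_space A"
      using ij by (auto simp: sum_zero_space_def axis_def sum_subtractf)
    then show False
      using hull a0 ij by (auto simp: axis_def)
  qed
  then have dG: "aff_dim G < aff_dim P"
    by (rule face_of_aff_dim_lt[OF cP Gf])
  have fFG: "F face_of G"
    by (rule face_of_subset[OF Ff FG face_of_imp_subset[OF Gf]])
  have "F = G"
  proof (rule ccontr)
    assume "F \<noteq> G"
    then have "aff_dim F < aff_dim G"
      by (rule face_of_aff_dim_lt[OF face_of_imp_convex[OF Gf] fFG])
    then show False
      using dG dF by linarith
  qed
  then show "\<exists>i\<in>A. \<exists>j\<in>A. \<exists>c. i \<noteq> j \<and> P \<subseteq> {x. x $ i - x $ j \<le> c} \<and>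
      F = P \<inter> {x. x $ i - x $ j = c}"
    using ij sub unfolding G_def by blast
qed

lemma facets_root_normal_imp_alcoved:
  assumes pol: "polytope P" and full: "affine hull P = sum_zero_space A"
    and nrm: "facets_root_normal A P"
  shows "alcoved A P"
proof -
  have cP: "convex P" and clP: "closed P" and bP: "bounded P"
    using pol by (auto simp: polytope_imp_convex polytope_imp_closed polytope_imp_bounded)
  have "0 \<in> sum_zero_space A"
    by (simp add: sum_zero_space_def)
  then have ne: "P \<noteq> {}"
    using full by auto
  have "\<forall>i j. \<exists>b. \<forall>x\<in>P. x $ i - x $ j \<le> b"
  proof (intro allI)
    fix i j
    obtain B where B: "\<And>x. x \<in> P \<Longrightarrow> norm x \<le> B"
      using bP unfolding bounded_iff by blast
    have "x $ i - x $ j \<le> 2 * B" if "x \<in> P" for x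
      using B[OF that] component_le_norm_cart[of x i] component_le_norm_cart[of x j] by linarith
    then show "\<exists>b. \<forall>x\<in>P. x $ i - x $ j \<le> b"
      by blast
  qed
  then have bdd: "bdd_above ((\<lambda>x. x $ i - x $ j) ` P)" for i j
    by (meson bdd_above.I2)
  define a where "a i j = (SUP x\<in>P. x $ i - x $ j)" for i j
  have le: "x $ i - x $ j \<le> a i j" if "x \<in> P" for x i j
    unfolding a_def by (rule cSUP_upper[OF that bdd])
  let ?Q = "{x \<in> sum_zero_space A. \<forall>i\<in>A. \<forall>j\<in>A. i \<noteq> j \<longrightarrow> x $ i - x $ j \<le> a i j}"
  have "P = ?Q"
  proof
    show "P \<subseteq> ?Q"
      using le hull_subset[of P affine] full by auto
    show "?Q \<subseteq> P"
    proof (rule subsetI, rule ccontr)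
      fix x assume x: "x \<in> ?Q" and xP: "x \<notin> P"
      obtain y where y: "y \<in> rel_interior P"
        using rel_interior_eq_empty[OF cP] ne by blast
      have yP: "y \<in> P"
        using y rel_interior_subset by blast
      have "y + (x - y) \<in> affine hull P"
        using x full by simp
      moreover have "x - y \<noteq> 0"
        using xP yP by auto
      ultimately obtain d where d: "0 < d" "y + d *\<^sub>R (x - y) \<in> rel_frontier P"
        "\<And>e. 0 \<le> e \<Longrightarrow> e < d \<Longrightarrow> y + e *\<^sub>R (x - y) \<in> rel_interior P"
        using ray_to_rel_frontier[OF bP y] by metis
      have d1: "d \<le> 1"
        using d(3)[of 1] xP rel_interior_subset by (force simp: not_le)
      let ?z = "y + d *\<^sub>R (x - y)"
      obtain F where F: "F facet_of P" "?z \<in> F"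
        using d(2) rel_frontier_of_polyhedron[OF polytope_imp_polyhedron[OF pol]] by auto
      then obtain i j c where ij: "i \<in> A" "j \<in> A" "i \<noteq> j"
        and c: "P \<subseteq> {x. x $ i - x $ j \<le> c}" and Fc: "F = P \<inter> {x. x $ i - x $ j = c}"
        using nrm unfolding facets_root_normal_def by blast
      have "F \<noteq> P"
        using F(1) by (auto simp: facet_of_def)
      then have "y \<notin> F"
        using face_of_disjoint_rel_interior[OF facet_of_imp_face_of[OF F(1)]] y by blast
      then have yc: "y $ i - y $ j < c"
        using yP c Fc by force
      have zc: "?z $ i - ?z $ j = c"
        using F(2) Fc by auto
      have ac: "a i j \<le> c"
        unfolding a_def using c ne by (intro cSUP_least) auto
      have xa: "x $ i - x $ j \<le> a i j"
        using x ij by auto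
      have "c = (y $ i - y $ j) + d * ((x $ i - x $ j) - (y $ i - y $ j))"
        using zc by (simp add: algebra_simps)
      then have e: "d * ((x $ i - x $ j) - (y $ i - y $ j)) = c - (y $ i - y $ j)"
        by linarith
      have "d \<noteq> 1"
      proof
        assume "d = 1"
        then have "x \<in> F" using F(2) by simp
        then show False using xP Fc by blast
      qed
      with d1 have "d < 1" by simp
      then have "d * (c - (y $ i - y $ j)) < c - (y $ i - y $ j)"
        using yc by simp
      moreover have "d * ((x $ i - x $ j) - (y $ i - y $ j)) \<le> d * (c - (y $ i - y $ j))"
        using xa ac d(1) by simp
      ultimately show False
        using e by linarith
    qed
  qed
  then show ?thesis
    unfolding alcoved_def using pol by blast
qed

theorem alcoved_iff_facets_root_normal:
  assumes "polytope P" "affine hull P = sum_zero_space A"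
  shows "alcoved A P \<longleftrightarrow> facets_root_normal A P"
  using assms alcoved_imp_facets_root_normal facets_root_normal_imp_alcoved by blast

subsection \<open>Sums of alcoved simplices of nondegenerate partitions\<close>

lemma alcoved_simplex_antimono:
  assumes S: "ordered_set_partition A S" and x: "x \<in> alcoved_simplex A S"
    and "k \<le> l" "l < length S" "i \<in> S ! k" "j \<in> S ! l"
  shows "x $ j \<le> x $ i"
  using assms(3-)
proof (induction l arbitrary: j rule: dec_induct)
  case base
  then show ?case
    using x unfolding alcoved_simplex_def by (metis (mono_tags, lifting) mem_Collect_eq nth_mem order_refl)
next
  case (step m)
  have "S ! m \<noteq> {}"
    using S step.prems unfolding ordered_set_partition_def by (metis Suc_lessD nth_mem)
  then obtain h where h: "h \<in> S ! m"
    by blast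
  then have "x $ h \<le> x $ i"
    using step by simp
  moreover have "x $ j \<le> x $ h"
    using x h step.prems unfolding alcoved_simplex_def by blast
  ultimately show ?case
    by simp
qed

lemma alcoved_simplex_diff_le:
  assumes S: "ordered_set_partition A S" and x: "x \<in> alcoved_simplex A S"
    and i: "i \<in> A" and j: "j \<in> A"
  shows "x $ i - x $ j \<le> 1"
proof -
  obtain k where k: "k < length S" "i \<in> S ! k"
    using S i unfolding ordered_set_partition_def by (metis UnionE in_set_conv_nth)
  obtain l where l: "l < length S" "j \<in> S ! l"
    using S j unfolding ordered_set_partition_def by (metis UnionE in_set_conv_nth)
  have ne: "S \<noteq> []"
    using k by auto
  then have "S ! 0 \<noteq> {}" "S ! (length S - 1) \<noteq> {}"
    using S unfolding ordered_set_partition_def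
    by (metis length_greater_0_conv nth_mem, metis diff_less length_greater_0_conv less_one nth_mem)
  then obtain p q where p: "p \<in> S ! 0" and q: "q \<in> S ! (length S - 1)"
    by blast
  have "x $ i \<le> x $ p"
    using alcoved_simplex_antimono[OF S x, of 0 k p i] k p by simp
  moreover have "x $ q \<le> x $ j"
    using alcoved_simplex_antimono[OF S x, of l "length S - 1" j q] l q by simp
  moreover have "x $ p - 1 \<le> x $ q"
    using x p q ne unfolding alcoved_simplex_def by (simp add: last_conv_nth hd_conv_nth)
  ultimately show ?thesis
    by linarith
qed

lemma bounded_alcoved_simplex:
  fixes S :: "'n::finite set list"
  assumes S: "ordered_set_partition A S"
  shows "bounded (alcoved_simplex A S)"
proof -
  have "norm x \<le> real CARD('n)" if x: "x \<in> alcoved_simplex A S" for x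
  proof -
    have x0: "(\<Sum>i\<in>A. x $ i) = 0" "\<And>i. i \<notin> A \<Longrightarrow> x $ i = 0"
      using x by (auto simp: alcoved_simplex_def sum_zero_space_def)
    have "\<bar>x $ i\<bar> \<le> 1" for i
    proof (cases "i \<in> A")
      case True
      have "real (card A) * x $ i = (\<Sum>j\<in>A. x $ i - x $ j)"
        by (simp add: sum_subtractf x0)
      moreover have "(\<Sum>j\<in>A. x $ i - x $ j) \<le> (\<Sum>j\<in>A. 1)"
        using alcoved_simplex_diff_le[OF S x True] by (intro sum_mono) auto
      moreover have "(\<Sum>j\<in>A. x $ i - x $ j) \<ge> (\<Sum>j\<in>A. - 1)"
      proof (rule sum_mono)
        fix j assume "j \<in> A"
        show "- 1 \<le> x $ i - x $ j"
          using alcoved_simplex_diff_le[OF S x \<open>j \<in> A\<close> True] by linarith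
      qed
      ultimately have "real (card A) * x $ i \<le> real (card A) * 1"
        "real (card A) * (- 1) \<le> real (card A) * x $ i"
        by simp_all
      moreover have "0 < real (card A)"
        using True by (auto simp: card_gt_0_iff)
      ultimately have "x $ i \<le> 1" "- 1 \<le> x $ i"
        by (simp_all only: mult_le_cancel_left_pos)
      then show ?thesis
        by linarith
    qed (simp add: x0)
    then have "(\<Sum>i\<in>UNIV. \<bar>x $ i\<bar>) \<le> (\<Sum>i\<in>(UNIV::'n set). 1)"
      by (intro sum_mono)
    then show ?thesis
      using norm_le_l1_cart[of x] by simp
  qed
  then show ?thesis
    unfolding bounded_iff by blast
qed

lemma polyhedron_alcoved_simplex:
  fixes S :: "'n::finite set list"
  shows "polyhedron (alcoved_simplex A S)"
proof -
  define h where "h = (\<lambda>(i, j, c). {x :: real ^ 'n. x $ j - x $ i \<le> c})"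
  have h: "polyhedron (h t)" for t
  proof -
    obtain i j c where t: "t = (i, j, c)"
      by (metis prod.exhaust)
    have "h t = {x. (axis j 1 - axis i 1) \<bullet> x \<le> c}"
      by (simp add: t h_def inner_diff_left inner_axis')
    then show ?thesis
      by (simp add: polyhedron_halfspace_le)
  qed
  define R where "R = (UNIV :: 'n set) \<times> (UNIV :: 'n set) \<times> {0, 1 :: real}"
  define K where "K = {(i, j, c) \<in> R.
     c = 0 \<and> (\<exists>B\<in>set S. i \<in> B \<and> j \<in> B) \<or>
     c = 0 \<and> (\<exists>k. Suc k < length S \<and> i \<in> S ! k \<and> j \<in> S ! Suc k) \<or>
     c = 1 \<and> S \<noteq> [] \<and> i \<in> last S \<and> j \<in> hd S}"
  have "finite K"
    by (rule finite_subset[of _ R]) (auto simp: K_def R_def)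
  then have "polyhedron (\<Inter> (h ` K))"
    by (intro polyhedron_Inter) (auto simp: h)
  moreover have "polyhedron (sum_zero_space A)"
    by (intro affine_imp_polyhedron subspace_imp_affine subspace_sum_zero_space)
  moreover have "alcoved_simplex A S = sum_zero_space A \<inter> \<Inter> (h ` K)"
  proof (rule set_eqI)
    fix x :: "real ^ 'n"
    have "x \<in> \<Inter> (h ` K) \<longleftrightarrow>
       (\<forall>B \<in> set S. \<forall>i\<in>B. \<forall>j\<in>B. x $ j - x $ i \<le> 0) \<and>
       (\<forall>k. Suc k < length S \<longrightarrow> (\<forall>i \<in> S ! k. \<forall>j \<in> S ! Suc k. x $ j - x $ i \<le> 0)) \<and>
       (S \<noteq> [] \<longrightarrow> (\<forall>i \<in> last S. \<forall>j \<in> hd S. x $ j - x $ i \<le> 1))"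
      unfolding K_def R_def h_def by (auto 0 4)
    moreover have "(\<forall>B \<in> set S. \<forall>i\<in>B. \<forall>j\<in>B. x $ j - x $ i \<le> 0) \<longleftrightarrow>
       (\<forall>B \<in> set S. \<forall>i\<in>B. \<forall>j\<in>B. x $ i = x $ j)"
    proof (intro iffI ballI)
      fix B i j
      assume *: "\<forall>B \<in> set S. \<forall>i\<in>B. \<forall>j\<in>B. x $ j - x $ i \<le> 0"
        and B: "B \<in> set S" "i \<in> B" "j \<in> B"
      have "x $ j - x $ i \<le> 0" "x $ i - x $ j \<le> 0"
        using * B by blast+
      then show "x $ i = x $ j"
        by linarith
    next
      fix B i j
      assume *: "\<forall>B \<in> set S. \<forall>i\<in>B. \<forall>j\<in>B. x $ i = x $ j"
        and B: "B \<in> set S" "i \<in> B" "j \<in> B"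
      have "x $ i = x $ j"
        using * B by blast
      then show "x $ j - x $ i \<le> 0"
        by simp
    qed
    ultimately show "x \<in> alcoved_simplex A S \<longleftrightarrow> x \<in> sum_zero_space A \<inter> \<Inter> (h ` K)"
      unfolding alcoved_simplex_def by (simp add: algebra_simps)
  qed
  ultimately show ?thesis
    by simp
qed

lemma polytope_alcoved_simplex:
  "ordered_set_partition A S \<Longrightarrow> polytope (alcoved_simplex A S)"
  by (simp add: polytope_eq_bounded_polyhedron bounded_alcoved_simplex polyhedron_alcoved_simplex)

lemma affine_hull_alcoved_simplex:
  fixes S :: "'n::finite set list"
  assumes S: "ordered_set_partition A S" and nd: "nondegenerate S"
  shows "affine hull (alcoved_simplex A S) = sum_zero_space A"
proof -
  have aff: "affine (sum_zero_space A)"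
    by (intro subspace_imp_affine subspace_sum_zero_space)
  define N where "N = real (length S)"
  define U where "U = {x :: real ^ 'n.
     (\<forall>(i, j) \<in> {(i, j). \<exists>k. Suc k < length S \<and> i \<in> S ! k \<and> j \<in> S ! Suc k}. x $ j < x $ i) \<and>
     (\<forall>(i, j) \<in> {(i, j). S \<noteq> [] \<and> i \<in> last S \<and> j \<in> hd S}. x $ j - 1 < x $ i)}"
  have "U = (\<Inter>(i, j) \<in> {(i, j). \<exists>k. Suc k < length S \<and> i \<in> S ! k \<and> j \<in> S ! Suc k}. {x. x $ j < x $ i}) \<inter>
     (\<Inter>(i, j) \<in> {(i, j). S \<noteq> [] \<and> i \<in> last S \<and> j \<in> hd S}. {x. x $ j - 1 < x $ i})"
    unfolding U_def by auto
  also have "open \<dots>"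
    by (intro open_Int open_INT ballI finite)
      (auto intro!: open_Collect_less continuous_intros)
  finally have "open U" .
  have eqs: "\<forall>B\<in>set S. \<forall>i\<in>B. \<forall>j\<in>B. x $ i = x $ j" for x :: "real ^ 'n"
    using nd unfolding nondegenerate_def by (metis is_singletonE singletonD)
  have sub: "sum_zero_space A \<inter> U \<subseteq> alcoved_simplex A S"
  proof
    fix x assume x: "x \<in> sum_zero_space A \<inter> U"
    have "x $ j \<le> x $ i" if "Suc k < length S" "i \<in> S ! k" "j \<in> S ! Suc k" for i j k
    proof -
      have "x $ j < x $ i"
        using x that unfolding U_def by blast
      then show ?thesis
        by simp
    qed
    moreover have "x $ j - 1 \<le> x $ i" if "S \<noteq> []" "i \<in> last S" "j \<in> hd S" for i j
    proof -
      have "x $ j - 1 < x $ i"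
        using x that unfolding U_def by blast
      then show ?thesis
        by simp
    qed
    ultimately show "x \<in> alcoved_simplex A S"
      using x eqs[of x] unfolding alcoved_simplex_def by blast
  qed
  have "sum_zero_space A \<inter> U \<noteq> {}"
  proof -
    define pos where "pos i = (THE k. k < length S \<and> i \<in> S ! k)" for i
    have pos: "pos i = k" if "k < length S" "i \<in> S ! k" for i k
      unfolding pos_def
    proof (rule the_equality)
      fix l assume l: "l < length S \<and> i \<in> S ! l"
      show "l = k"
        using S l that unfolding ordered_set_partition_def by (metis IntI empty_iff)
    qed (use that in simp)
    define m where "m = (\<Sum>i\<in>A. - real (pos i) / N) / real (card A)"
    define x :: "real ^ 'n" where "x = (\<chi> i. if i \<in> A then - real (pos i) / N - m else 0)"
    have inA: "i \<in> A" if "k < length S" "i \<in> S ! k" for i k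
      using that S unfolding ordered_set_partition_def by (metis UnionI nth_mem)
    have "x \<in> sum_zero_space A"
    proof -
      have "(\<Sum>i\<in>A. x $ i) = (\<Sum>i\<in>A. - real (pos i) / N - m)"
        by (intro sum.cong) (auto simp: x_def)
      also have "\<dots> = (\<Sum>i\<in>A. - real (pos i) / N) - real (card A) * m"
        by (subst sum_subtractf) simp
      also have "\<dots> = 0"
        by (cases "A = {}") (simp_all add: m_def)
      finally show ?thesis
        by (simp add: sum_zero_space_def x_def)
    qed
    moreover have "x \<in> U"
    proof -
      have val: "x $ i = - real k / N - m" if "k < length S" "i \<in> S ! k" for i k
        using pos[OF that] inA[OF that] by (simp add: x_def)
      have 1: "x $ j < x $ i" if "Suc k < length S" "i \<in> S ! k" "j \<in> S ! Suc k" for i j k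
      proof -
        have "0 < N"
          using that(1) unfolding N_def by linarith
        then have "real k / N < real (Suc k) / N"
          by (intro divide_strict_right_mono) auto
        moreover have "x $ i = - (real k / N) - m" "x $ j = - (real (Suc k) / N) - m"
          using val[of k i] val[of "Suc k" j] that by (simp_all only: minus_divide_left Suc_lessD)
        ultimately show ?thesis
          by linarith
      qed
      have 2: "x $ j - 1 < x $ i" if "S \<noteq> []" "i \<in> last S" "j \<in> hd S" for i j
      proof -
        have N: "0 < N" "real (length S - 1) = N - 1"
          using that(1) by (simp_all add: N_def Suc_leI of_nat_diff)
        have "x $ i = - ((N - 1) / N) - m"
          using val[of "length S - 1" i] that N by (simp add: last_conv_nth)
        moreover have "x $ j = - m"
          using val[of 0 j] that by (simp add: hd_conv_nth)
        moreover have "(N - 1) / N < 1"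
          using N(1) by simp
        ultimately show ?thesis
          by linarith
      qed
      show ?thesis
        unfolding U_def using 1 2 by auto
    qed
    ultimately show ?thesis
      by blast
  qed
  then have "affine hull (sum_zero_space A \<inter> U) = sum_zero_space A"
    using affine_hull_affine_Int_open[OF aff \<open>open U\<close>] aff by (simp add: affine_hull_eq)
  moreover have "affine hull (alcoved_simplex A S) \<subseteq> sum_zero_space A"
    using aff by (intro hull_minimal) (auto simp: alcoved_simplex_def)
  ultimately show ?thesis
    using hull_mono[OF sub, of affine] by auto
qed

theorem compatible_iff_facets_root_normal:
  fixes S T :: "'n::finite set list"
  assumes S: "ordered_set_partition A S" "nondegenerate S"
    and T: "ordered_set_partition A T" "nondegenerate T"
  shows "compatible A S T \<longleftrightarrow>
    facets_root_normal A (alcoved_simplex A S + alcoved_simplex A T)"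
proof -
  let ?P = "alcoved_simplex A S + alcoved_simplex A T"
  obtain V W where V: "finite V" "alcoved_simplex A S = convex hull V"
    and W: "finite W" "alcoved_simplex A T = convex hull W"
    using polytope_alcoved_simplex S(1) T(1) unfolding polytope_def by metis
  then have "?P = convex hull (V + W)"
    by (simp add: convex_hull_set_plus)
  then have "polytope ?P"
    using V(1) W(1) finite_set_plus unfolding polytope_def by blast
  moreover have "affine hull ?P = sum_zero_space A"
  proof
    have sub: "subspace (sum_zero_space A)"
      by (rule subspace_sum_zero_space)
    show "affine hull ?P \<subseteq> sum_zero_space A"
      using sub by (intro hull_minimal subspace_imp_affine)
        (auto simp: set_plus_def alcoved_simplex_def intro: subspace_add)
    have "alcoved_simplex A T \<noteq> {}"
      using affine_hull_alcoved_simplex[OF T] subspace_0[OF sub] by auto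
    then obtain y where y: "y \<in> alcoved_simplex A T"
      by blast
    have yH: "y \<in> sum_zero_space A"
      using y by (simp add: alcoved_simplex_def)
    have "(+) y ` alcoved_simplex A S \<subseteq> ?P"
      using y by (auto simp: set_plus_def add.commute)
    then have "affine hull ((+) y ` alcoved_simplex A S) \<subseteq> affine hull ?P"
      by (rule hull_mono)
    then have im: "(+) y ` sum_zero_space A \<subseteq> affine hull ?P"
      by (simp add: affine_hull_translation affine_hull_alcoved_simplex[OF S])
    show "sum_zero_space A \<subseteq> affine hull ?P"
    proof
      fix x assume "x \<in> sum_zero_space A"
      then have "x - y \<in> sum_zero_space A"
        using sub yH by (intro subspace_diff)
      then have "y + (x - y) \<in> affine hull ?P"
        using im by blast
      then show "x \<in> affine hull ?P"
        by simp
    qed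
  qed
  ultimately show ?thesis
    unfolding compatible_def by (rule alcoved_iff_facets_root_normal)
qed

end

theory Submission
  imports Defs
begin

text \<open>
  Writing \<open>a\<^sub>S u v = 1\<close> if \<open>u\<close> precedes \<open>v\<close> in \<open>S\<close> and \<open>0\<close> otherwise, the alcoved simplex of \<open>S\<close> is
  cut out by \<open>x\<^sub>u - x\<^sub>v \<le> a\<^sub>S u v\<close>, and all these bounds are attained.  So \<open>S\<close> and \<open>T\<close> are compatible
  iff every \<open>x\<close> with \<open>x\<^sub>u - x\<^sub>v \<le> a\<^sub>S u v + a\<^sub>T u v\<close> splits as \<open>y + z\<close> with \<open>y\<close>, \<open>z\<close> in the two simplices.
  For fixed \<open>x\<close> this is a system of difference constraints on \<open>y\<close>, and an unsolvable one has a
  negative cycle \<open>i\<^sub>0 \<rightarrow> j\<^sub>0 \<rightarrow> i\<^sub>1 \<rightarrow> j\<^sub>1 \<rightarrow> \<dots>\<close> that alternates between constraints from \<open>S\<close> and from \<open>T\<close>.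
  In a shortest such cycle no two constraints of the same kind can be exchanged, which forces the
  cyclic orders \<open>(j\<^sub>m, i\<^sub>m, j\<^sub>l, i\<^sub>l)\<close> in \<open>S\<close> and \<open>(j\<^sub>m, i\<^sub>m\<^sub>+\<^sub>1, j\<^sub>l, i\<^sub>l\<^sub>+\<^sub>1)\<close> in \<open>T\<close> for all \<open>m \<noteq> l\<close>.
  Looking at \<open>m - 1\<close>, \<open>m\<close>, \<open>m + 1\<close> one then finds a 6-interlacing, unless \<open>T\<close> contains
  \<open>(j\<^sub>m, j\<^sub>m\<^sub>-\<^sub>1, j\<^sub>m\<^sub>-\<^sub>2, j\<^sub>m\<^sub>+\<^sub>1)\<close> for all \<open>m\<close>; by symmetry \<open>S\<close> then contains \<open>(j\<^sub>m, j\<^sub>m\<^sub>+\<^sub>1, j\<^sub>m\<^sub>+\<^sub>2, j\<^sub>m\<^sub>-\<^sub>1)\<close>,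
  and this is a 4-interlacing.  Conversely, interlaced elements give an explicit \<open>x\<close>
  that does not split: the indicator function of a down-set of the intersection of the two orders.
\<close>

subsection \<open>Cyclic orders\<close>

text \<open>Phrased with \<open>rotate\<close> to match \<open>cyclic_eq\<close> in
  \<open>cyclic_eq_restrict_iff\<close>; calculations use the explicit disjunction
  \<open>cyc4_iff\<close> instead.\<close>

definition cyc4 :: "nat \<Rightarrow> nat \<Rightarrow> nat \<Rightarrow> nat \<Rightarrow> bool" where
  "cyc4 a b c d \<longleftrightarrow> (\<exists>k<4. sorted_wrt (<) (rotate k [a, b, c, d]))"

definition cyc6 :: "nat \<Rightarrow> nat \<Rightarrow> nat \<Rightarrow> nat \<Rightarrow> nat \<Rightarrow> nat \<Rightarrow> bool" where
  "cyc6 a b c d e f \<longleftrightarrow> (\<exists>k<6. sorted_wrt (<) (rotate k [a, b, c, d, e, f]))"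

lemma sorted_wrt_less_Cons2: "sorted_wrt (<) (a # b # xs) \<longleftrightarrow> a < b \<and> sorted_wrt (<) (b # xs)"
  for a b :: nat
  by (rule sorted_wrt2) (rule transp_on_less)

lemma cyc4_iff:
  "cyc4 a b c d \<longleftrightarrow> a < b \<and> b < c \<and> c < d \<or> b < c \<and> c < d \<and> d < a \<or>
     c < d \<and> d < a \<and> a < b \<or> d < a \<and> a < b \<and> b < c"
proof -
  have *: "k < 4 \<longleftrightarrow> k = 0 \<or> k = 1 \<or> k = 2 \<or> k = 3" for k :: nat
    by arith
  show ?thesis
    unfolding cyc4_def * conj_disj_distribR ex_disj_distrib simp_thms
    by (simp add: numeral_eq_Suc sorted_wrt_less_Cons2 sorted_wrt1 del: sorted_wrt.simps(2))
qed

lemma cyc6_iff: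
  "cyc6 a b c d e f \<longleftrightarrow>
     a < b \<and> b < c \<and> c < d \<and> d < e \<and> e < f \<or> b < c \<and> c < d \<and> d < e \<and> e < f \<and> f < a \<or>
     c < d \<and> d < e \<and> e < f \<and> f < a \<and> a < b \<or> d < e \<and> e < f \<and> f < a \<and> a < b \<and> b < c \<or>
     e < f \<and> f < a \<and> a < b \<and> b < c \<and> c < d \<or> f < a \<and> a < b \<and> b < c \<and> c < d \<and> d < e"
proof -
  have *: "k < 6 \<longleftrightarrow> k = 0 \<or> k = 1 \<or> k = 2 \<or> k = 3 \<or> k = 4 \<or> k = 5" for k :: nat
    by arith
  show ?thesis
    unfolding cyc6_def * conj_disj_distribR ex_disj_distrib simp_thms
    by (simp add: numeral_eq_Suc sorted_wrt_less_Cons2 sorted_wrt1 del: sorted_wrt.simps(2))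
qed

definition cyc3 :: "nat \<Rightarrow> nat \<Rightarrow> nat \<Rightarrow> bool" where
  "cyc3 a b c \<longleftrightarrow> a < b \<and> b < c \<or> b < c \<and> c < a \<or> c < a \<and> a < b"

lemma cyc4_iff_cyc3: "cyc4 a b c d \<longleftrightarrow> cyc3 a b c \<and> cyc3 a c d"
  unfolding cyc4_iff cyc3_def by auto

lemma cyc6_iff_cyc4: "cyc6 a b c d e f \<longleftrightarrow> cyc4 a b c d \<and> cyc4 a d e f"
  unfolding cyc4_iff cyc6_iff by (rule iffI; elim conjE disjE; simp)

text \<open>The axioms of a cyclic order. They let \<open>interlaced_step\<close> deduce new orders
  from old ones without choosing a cut point.\<close>

lemma cyc3_rules:
  shows cyc3_rotate: "cyc3 a b c \<Longrightarrow> cyc3 b c a"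
    and cyc3_asym: "cyc3 a b c \<Longrightarrow> \<not> cyc3 a c b"
    and cyc3_trans: "cyc3 a b c \<Longrightarrow> cyc3 a c d \<Longrightarrow> cyc3 a b d"
    and cyc3_total: "cyc3 a b c \<or> cyc3 a c b \<or> a = b \<or> b = c \<or> a = c"
    and cyc3_distinct: "cyc3 a b c \<Longrightarrow> a \<noteq> b \<and> b \<noteq> c \<and> a \<noteq> c"
  unfolding cyc3_def by auto

lemma cyc4_rotate: "cyc4 a b c d \<Longrightarrow> cyc4 b c d a"
  unfolding cyc4_iff by auto

section \<open>Interlacings from an alternating cycle\<close>

text \<open>Indices live in an abstract set with successor \<sigma> and predecessor \<tau>, not
  modulo \<open>k\<close>, so that the lemma can be reused with \<sigma> and \<tau>, and
  \<open>p\<close> and \<open>q\<close>, interchanged.\<close>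

lemma interlaced_step:
  fixes p q :: "'a \<Rightarrow> nat" and i j :: "'k \<Rightarrow> 'a"
  assumes \<sigma>: "\<And>m. m \<in> K \<Longrightarrow> \<sigma> m \<in> K \<and> \<tau> m \<in> K \<and> \<sigma> (\<tau> m) = m \<and> \<tau> (\<sigma> m) = m \<and> \<sigma> m \<noteq> m"
    and A: "\<And>m. m \<in> K \<Longrightarrow> i m \<in> A \<and> j m \<in> A"
    and S: "\<And>m l. m \<in> K \<Longrightarrow> l \<in> K \<Longrightarrow> m \<noteq> l \<Longrightarrow> cyc4 (p (j m)) (p (i m)) (p (j l)) (p (i l))"
    and T: "\<And>m l. m \<in> K \<Longrightarrow> l \<in> K \<Longrightarrow> m \<noteq> l \<Longrightarrow>
      cyc4 (q (j m)) (q (i (\<sigma> m))) (q (j l)) (q (i (\<sigma> l)))"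
    and no4: "\<And>a b c d. a \<in> A \<Longrightarrow> b \<in> A \<Longrightarrow> c \<in> A \<Longrightarrow> d \<in> A \<Longrightarrow>
      cyc4 (p a) (p b) (p c) (p d) \<Longrightarrow> \<not> cyc4 (q c) (q b) (q a) (q d)"
    and no6: "\<And>a b c d e f. a \<in> A \<Longrightarrow> b \<in> A \<Longrightarrow> c \<in> A \<Longrightarrow> d \<in> A \<Longrightarrow> e \<in> A \<Longrightarrow> f \<in> A \<Longrightarrow>
      cyc6 (p a) (p b) (p c) (p d) (p e) (p f) \<Longrightarrow> \<not> cyc6 (q a) (q d) (q e) (q b) (q c) (q f)"
    and m: "m \<in> K"
  shows "cyc4 (q (j m)) (q (j (\<tau> m))) (q (j (\<tau> (\<tau> m)))) (q (j (\<sigma> m)))"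
proof -
  define s t u where "s = \<sigma> m" and "t = \<tau> m" and "u = \<tau> t"
  have K: "s \<in> K" "t \<in> K" "u \<in> K" "\<sigma> s \<in> K" and eq: "\<sigma> t = m" "\<sigma> u = t" "\<tau> s = m"
    and ne: "s \<noteq> m" "t \<noteq> m" "u \<noteq> t" "\<sigma> s \<noteq> s"
    unfolding s_def t_def u_def using \<sigma> m by metis+
  have T1: "cyc4 (q (j m)) (q (i s)) (q (j t)) (q (i m))"
    using T[OF m K(2)] ne eq by (simp add: s_def)
  \<comment> \<open>With \<open>s = t\<close>, rotating \<open>T1\<close> by two places gives the
    second half of a 4-interlacing whose first half is assumption \<open>S\<close> for
    \<open>m\<close> and \<open>s\<close>.\<close>
  have st: "s \<noteq> t"
  proof
    assume "s = t"
    then show False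
      using no4[of "j m" "i m" "j s" "i s"] S[OF m K(1)] T1 A m K ne cyc4_rotate by metis
  qed
  have um: "u \<noteq> m"
    using st eq \<open>\<sigma> u = t\<close> s_def by metis
  have T2: "cyc4 (q (j m)) (q (i s)) (q (j s)) (q (i (\<sigma> s)))"
    using T[OF m K(1)] ne by (simp add: s_def)
  have T3: "cyc4 (q (j t)) (q (i m)) (q (j s)) (q (i (\<sigma> s)))"
    using T[OF K(2) K(1)] st eq by simp
  have T4: "cyc4 (q (j u)) (q (i t)) (q (j m)) (q (i s))"
    using T[OF K(3) m] um eq by (simp add: s_def)
  have T5: "cyc4 (q (j u)) (q (i t)) (q (j t)) (q (i m))"
    using T[OF K(3) K(2)] ne eq by simp
  have S1: "cyc4 (p (j m)) (p (i m)) (p (j s)) (p (i s))"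
    using S[OF m K(1)] ne by simp
  have S2: "cyc4 (p (j m)) (p (i m)) (p (j t)) (p (i t))"
    using S[OF m K(2)] ne by simp
  have S3: "cyc4 (p (j s)) (p (i s)) (p (j t)) (p (i t))"
    using S[OF K(1) K(2)] st by simp
  have inA: "i m \<in> A" "j m \<in> A" "i s \<in> A" "j s \<in> A" "i t \<in> A" "j t \<in> A"
    using A m K by auto
  have N1: "\<not> cyc4 (q (j s)) (q (i m)) (q (j m)) (q (i s))"
    using no4[of "j m" "i m" "j s" "i s"] S1 inA by simp
  have N2: "\<not> cyc4 (q (j t)) (q (i m)) (q (j m)) (q (i t))"
    using no4[of "j m" "i m" "j t" "i t"] S2 inA by simp
  \<comment> \<open>Between \<open>i s\<close> and \<open>j m\<close>, the element
    \<open>j s\<close> can lie before or after \<open>i m\<close>; \<open>N1\<close> excludes the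
    former. \<open>N2\<close> settles the place of \<open>i t\<close> in the same way.\<close>
  have J: "cyc4 (q (i s)) (q (i m)) (q (j s)) (q (j m))"
    using T1 T2 T3 N1 unfolding cyc4_iff_cyc3 by (smt (verit) cyc3_rules)
  have I: "cyc4 (q (j t)) (q (i m)) (q (i t)) (q (j m))"
    using T1 T4 T5 N2 unfolding cyc4_iff_cyc3 by (smt (verit) cyc3_rules)
  \<comment> \<open>With \<open>j s\<close> before \<open>i t\<close>, all six elements are ordered
    in \<open>q\<close>; either cyclic order of the three pairs in \<open>p\<close> then gives an
    interlacing.\<close>
  have X: "\<not> cyc4 (q (i m)) (q (j s)) (q (i t)) (q (j m))"
  proof
    assume X: "cyc4 (q (i m)) (q (j s)) (q (i t)) (q (j m))"
    have q6: "cyc6 (q (j m)) (q (i s)) (q (j t)) (q (i m)) (q (j s)) (q (i t))"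
      using X T1 unfolding cyc4_iff cyc6_iff by (elim conjE disjE; simp)
    consider "cyc6 (p (j m)) (p (i m)) (p (j s)) (p (i s)) (p (j t)) (p (i t))"
      | "cyc6 (p (j m)) (p (i m)) (p (j t)) (p (i t)) (p (j s)) (p (i s))"
      using S1 S2 S3 unfolding cyc4_iff cyc6_iff by (elim conjE disjE; simp)
    then show False
    proof cases
      case 1
      then show False
        using no6[of "j m" "i m" "j s" "i s" "j t" "i t"] q6 inA by simp
    next
      case 2
      then have "cyc4 (p (j m)) (p (i m)) (p (j t)) (p (i s))"
        unfolding cyc4_iff cyc6_iff by (elim disjE conjE) simp_all
      moreover have "cyc4 (q (j t)) (q (i m)) (q (j m)) (q (i s))"
        using q6 unfolding cyc4_iff cyc6_iff by (elim disjE conjE) simp_all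
      ultimately show False
        using no4[of "j m" "i m" "j t" "i s"] inA by simp
    qed
  qed
  \<comment> \<open>If \<open>u = s\<close>, the indices close up after three steps and
    \<open>T5\<close> puts \<open>j s\<close> before \<open>i t\<close>, which \<open>X\<close>
    forbids.\<close>
  have "u \<noteq> s"
  proof
    assume "u = s"
    then have "cyc4 (q (i m)) (q (j s)) (q (i t)) (q (j m))"
      using T5 I J unfolding cyc4_iff_cyc3 by (smt (verit) cyc3_rules)
    then show False
      using X by blast
  qed
  then have "q (j s) \<noteq> q (i t)"
    using T[OF K(3) K(1)] eq by (auto simp: cyc4_iff)
  then have Y: "cyc4 (q (i m)) (q (i t)) (q (j s)) (q (j m))"
    using X I J unfolding cyc4_iff_cyc3 by (smt (verit) cyc3_rules)
  \<comment> \<open>Now \<open>q\<close> has the cyclic order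
    \<open>j t, i m, i t, j s, j m\<close>, and \<open>T4\<close> and \<open>T5\<close> place
    \<open>j u\<close> between \<open>i m\<close> and \<open>i t\<close>.\<close>
  have "cyc4 (q (j m)) (q (j t)) (q (j u)) (q (j s))"
    using T1 T4 T5 Y unfolding cyc4_iff_cyc3 by (smt (verit) cyc3_rules)
  then show ?thesis
    by (simp add: s_def t_def u_def)
qed

text \<open>The hypotheses are invariant under exchanging \<open>p\<close> with \<open>q\<close> and
  \<sigma> with \<tau> while \<open>i m\<close> becomes \<open>i (\<sigma> m)\<close>. Thus
  \<open>interlaced_step\<close> orders the same four members of the family \<open>j\<close> in both
  \<open>q\<close> and \<open>p\<close>, and the two orders form the 4-interlacing pattern.\<close>

lemma interlaced_of_alternating:
  fixes p q :: "'a \<Rightarrow> nat" and i j :: "'k \<Rightarrow> 'a"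
  assumes \<sigma>: "\<And>m. m \<in> K \<Longrightarrow> \<sigma> m \<in> K \<and> \<tau> m \<in> K \<and> \<sigma> (\<tau> m) = m \<and> \<tau> (\<sigma> m) = m \<and> \<sigma> m \<noteq> m"
    and A: "\<And>m. m \<in> K \<Longrightarrow> i m \<in> A \<and> j m \<in> A"
    and S: "\<And>m l. m \<in> K \<Longrightarrow> l \<in> K \<Longrightarrow> m \<noteq> l \<Longrightarrow> cyc4 (p (j m)) (p (i m)) (p (j l)) (p (i l))"
    and T: "\<And>m l. m \<in> K \<Longrightarrow> l \<in> K \<Longrightarrow> m \<noteq> l \<Longrightarrow>
      cyc4 (q (j m)) (q (i (\<sigma> m))) (q (j l)) (q (i (\<sigma> l)))"
    and "K \<noteq> {}"
  shows "(\<exists>a\<in>A. \<exists>b\<in>A. \<exists>c\<in>A. \<exists>d\<in>A.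
      cyc4 (p a) (p b) (p c) (p d) \<and> cyc4 (q c) (q b) (q a) (q d)) \<or>
    (\<exists>a\<in>A. \<exists>b\<in>A. \<exists>c\<in>A. \<exists>d\<in>A. \<exists>e\<in>A. \<exists>f\<in>A.
      cyc6 (p a) (p b) (p c) (p d) (p e) (p f) \<and> cyc6 (q a) (q d) (q e) (q b) (q c) (q f))"
proof (rule ccontr)
  assume "\<not> ?thesis"
  then have no4: "\<And>a b c d. a \<in> A \<Longrightarrow> b \<in> A \<Longrightarrow> c \<in> A \<Longrightarrow> d \<in> A \<Longrightarrow>
      cyc4 (p a) (p b) (p c) (p d) \<Longrightarrow> \<not> cyc4 (q c) (q b) (q a) (q d)"
    and no6: "\<And>a b c d e f. a \<in> A \<Longrightarrow> b \<in> A \<Longrightarrow> c \<in> A \<Longrightarrow> d \<in> A \<Longrightarrow> e \<in> A \<Longrightarrow> f \<in> A \<Longrightarrow>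
      cyc6 (p a) (p b) (p c) (p d) (p e) (p f) \<Longrightarrow> \<not> cyc6 (q a) (q d) (q e) (q b) (q c) (q f)"
    by blast+
  obtain m where m: "m \<in> K"
    using \<open>K \<noteq> {}\<close> by blast
  have s: "\<sigma> m \<in> K" "\<tau> (\<sigma> m) = m"
    using \<sigma>[OF m] by auto
  \<comment> \<open>Taken at \<open>\<sigma> m\<close> rather than \<open>m\<close>, so that it
    concerns the same four elements as \<open>2\<close>.\<close>
  have 1: "cyc4 (q (j (\<sigma> m))) (q (j m)) (q (j (\<tau> m))) (q (j (\<sigma> (\<sigma> m))))"
    using interlaced_step[of K \<sigma> \<tau> i A j p q "\<sigma> m", OF \<sigma> A S T no4 no6 s(1)] s(2) by simp
  have \<tau>: "\<tau> m \<in> K \<and> \<sigma> m \<in> K \<and> \<tau> (\<sigma> m) = m \<and> \<sigma> (\<tau> m) = m \<and> \<tau> m \<noteq> m" if "m \<in> K" for m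
    using \<sigma>[OF that] by metis
  have 2: "cyc4 (p (j m)) (p (j (\<sigma> m))) (p (j (\<sigma> (\<sigma> m)))) (p (j (\<tau> m)))"
  proof (rule interlaced_step[of K \<tau> \<sigma> "\<lambda>m. i (\<sigma> m)" A j q p, OF \<tau> _ T])
    \<comment> \<open>Each excluded pattern is an involution on the labels, so excluding it is
      symmetric in \<open>p\<close> and \<open>q\<close>.\<close>
    fix a b c d assume A: "a \<in> A" "b \<in> A" "c \<in> A" "d \<in> A"
      and "cyc4 (q a) (q b) (q c) (q d)"
    then show "\<not> cyc4 (p c) (p b) (p a) (p d)"
      using no4[of c b a d] by blast
  next
    fix a b c d e f assume A: "a \<in> A" "b \<in> A" "c \<in> A" "d \<in> A" "e \<in> A" "f \<in> A"
      and "cyc6 (q a) (q b) (q c) (q d) (q e) (q f)"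
    then show "\<not> cyc6 (p a) (p d) (p e) (p b) (p c) (p f)"
      using no6[of a d e b c f] by blast
  next
    show "i (\<sigma> m) \<in> A \<and> j m \<in> A" if "m \<in> K" for m
      using \<sigma>[OF that] A that by blast
    show "cyc4 (p (j m)) (p (i (\<sigma> (\<tau> m)))) (p (j l)) (p (i (\<sigma> (\<tau> l))))"
      if "m \<in> K" "l \<in> K" "m \<noteq> l" for m l
      using S[OF that] \<sigma>[OF that(1)] \<sigma>[OF that(2)] by simp
  qed (simp_all add: m)
  have "cyc4 (q (j (\<sigma> (\<sigma> m)))) (q (j (\<sigma> m))) (q (j m)) (q (j (\<tau> m)))"
    using 1 cyc4_rotate by blast
  then show False
    using no4[OF _ _ _ _ 2] A \<sigma> m by blast
qed

subsection \<open>Difference constraints and negative cycles\<close>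

text \<open>A pair \<open>(i, j)\<close> in a walk stands for an \<open>\<alpha>\<close>-step from \<open>i\<close> to \<open>j\<close>, followed by a \<open>\<beta>\<close>-step from \<open>j\<close>
  to the next pair, or to the end \<open>v\<close> of the walk, which is not part of the list.\<close>

definition walk_start :: "('a \<times> 'a) list \<Rightarrow> 'a \<Rightarrow> 'a" where
  "walk_start ps v = (if ps = [] then v else fst (hd ps))"

fun walk_weight :: "('a \<Rightarrow> 'a \<Rightarrow> real) \<Rightarrow> ('a \<Rightarrow> 'a \<Rightarrow> real) \<Rightarrow> ('a \<times> 'a) list \<Rightarrow> 'a \<Rightarrow> real" where
  "walk_weight \<alpha> \<beta> [] v = 0"
| "walk_weight \<alpha> \<beta> ((i, j) # ps) v = \<alpha> i j + \<beta> j (walk_start ps v) + walk_weight \<alpha> \<beta> ps v"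

lemma walk_start_simps [simp]:
  "walk_start [] v = v" "walk_start (p # ps) v = fst p"
  "walk_start (ps @ qs) v = walk_start ps (walk_start qs v)"
  by (auto simp: walk_start_def)

lemma walk_weight_append:
  "walk_weight \<alpha> \<beta> (xs @ ys) v = walk_weight \<alpha> \<beta> xs (walk_start ys v) + walk_weight \<alpha> \<beta> ys v"
  by (induction xs) auto

definition negative_cycle where
  "negative_cycle \<alpha> \<beta> A ps \<longleftrightarrow> set ps \<subseteq> A \<times> A \<and> ps \<noteq> [] \<and>
     walk_weight \<alpha> \<beta> ps (fst (hd ps)) < 0"

text \<open>Between two pairs with the same first vertex lies a closed walk of nonnegative weight,
  so deleting it does not raise the weight. What remains are walks with distinct first vertices, and
  only finitely many of these exist.\<close>

lemma walk_weight_bounded_below: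
  assumes "finite A" and nn: "\<And>ps. \<not> negative_cycle \<alpha> \<beta> A ps"
  shows "\<exists>B. \<forall>ps v. set ps \<subseteq> A \<times> A \<longrightarrow> v \<in> A \<longrightarrow> B \<le> walk_weight \<alpha> \<beta> ps v"
proof -
  define L where "L = {ps. set ps \<subseteq> A \<times> A \<and> length ps \<le> card A}"
  define B where "B = Min (case_prod (walk_weight \<alpha> \<beta>) ` (L \<times> A))"
  have fin: "finite (case_prod (walk_weight \<alpha> \<beta>) ` (L \<times> A))"
    unfolding L_def using finite_lists_length_le[of "A \<times> A" "card A"] \<open>finite A\<close> by auto
  have "B \<le> walk_weight \<alpha> \<beta> ps v" if "set ps \<subseteq> A \<times> A" "v \<in> A" for ps v
    using that(1)
  proof (induction ps rule: length_induct)
    case (1 ps)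
    show ?case
    proof (cases "distinct (map fst ps)")
      case True
      have "length ps = card (fst ` set ps)"
        using True by (metis distinct_card length_map set_map)
      also have "\<dots> \<le> card A"
        using "1.prems" \<open>finite A\<close> by (intro card_mono) auto
      finally have "ps \<in> L"
        using "1.prems" by (simp add: L_def)
      then show ?thesis
        unfolding B_def using fin that(2) by (intro Min_le) force+
    next
      case False
      then obtain as bs cs i where "map fst ps = as @ [i] @ bs @ [i] @ cs"
        using not_distinct_decomp by blast
      then obtain xs ys zs j j' where ps: "ps = xs @ (i, j) # ys @ (i, j') # zs"
        by (auto simp: map_eq_append_conv map_eq_Cons_conv append_eq_map_conv Cons_eq_map_conv)
      have "\<not> negative_cycle \<alpha> \<beta> A ((i, j) # ys)"
        by (rule nn)
      then have "0 \<le> walk_weight \<alpha> \<beta> ((i, j) # ys) i"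
        using "1.prems" ps by (auto simp: negative_cycle_def)
      moreover have "B \<le> walk_weight \<alpha> \<beta> (xs @ (i, j') # zs) v"
        using "1.IH" "1.prems" ps by auto
      ultimately show ?thesis
        by (simp add: ps walk_weight_append)
    qed
  qed
  then show ?thesis
    by blast
qed

text \<open>The potential of a vertex is the infimum of the weights of the walks that start there.\<close>

lemma potential_exists:
  assumes "finite A" and nn: "\<And>ps. \<not> negative_cycle \<alpha> \<beta> A ps"
    and \<alpha>0: "\<And>v. \<alpha> v v = 0" and \<beta>0: "\<And>v. \<beta> v v = 0"
  shows "\<exists>y. \<forall>u\<in>A. \<forall>v\<in>A. y u - y v \<le> \<alpha> u v \<and> y u - y v \<le> \<beta> u v"
proof -
  obtain B where B: "\<And>ps v. set ps \<subseteq> A \<times> A \<Longrightarrow> v \<in> A \<Longrightarrow> B \<le> walk_weight \<alpha> \<beta> ps v"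
    using walk_weight_bounded_below[OF assms(1) nn] by blast
  define W where "W u = {walk_weight \<alpha> \<beta> ps v |ps v. set ps \<subseteq> A \<times> A \<and> v \<in> A \<and> walk_start ps v = u}"
    for u
  have bdd: "bdd_below (W u)" for u
    unfolding W_def using B by (auto intro!: bdd_belowI[of _ B])
  have ne: "W u \<noteq> {}" if "u \<in> A" for u
    unfolding W_def using that by (auto intro!: exI[of _ "[]"])
  have *: "Inf (W u) - Inf (W v) \<le> \<alpha> u t + \<beta> t v" if "u \<in> A" "t \<in> A" "v \<in> A" for u t v
  proof -
    have "Inf (W u) - (\<alpha> u t + \<beta> t v) \<le> Inf (W v)"
    proof (rule cInf_greatest[OF ne[OF that(3)]])
      fix w assume "w \<in> W v"
      then obtain ps z where ps: "w = walk_weight \<alpha> \<beta> ps z" "set ps \<subseteq> A \<times> A" "z \<in> A" "walk_start ps z = v"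
        unfolding W_def by blast
      have "walk_weight \<alpha> \<beta> ((u, t) # ps) z \<in> W u"
        unfolding W_def using ps that
        by (intro CollectI exI[of _ "(u, t) # ps"] exI[of _ z]) auto
      then have "Inf (W u) \<le> walk_weight \<alpha> \<beta> ((u, t) # ps) z"
        by (rule cInf_lower[OF _ bdd])
      then show "Inf (W u) - (\<alpha> u t + \<beta> t v) \<le> w"
        using ps by simp
    qed
    then show ?thesis
      by simp
  qed
  \<comment> \<open>A lone \<alpha>-step is completed by the \<beta>-loop at \<open>v\<close>, a
    lone \<beta>-step by the \<alpha>-loop at \<open>u\<close>; loops cost 0.\<close>
  have "Inf (W u) - Inf (W v) \<le> \<alpha> u v \<and> Inf (W u) - Inf (W v) \<le> \<beta> u v" if "u \<in> A" "v \<in> A" for u v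
    using *[OF that(1) that(2) that(2)] *[OF that(1) that(1) that(2)] \<alpha>0 \<beta>0 by simp
  then show ?thesis
    by (intro exI[of _ "\<lambda>u. Inf (W u)"]) blast
qed

text \<open>Exchanging the ends of two \<open>\<alpha>\<close>-steps, or of two \<open>\<beta>\<close>-steps, splits a cycle in two shorter ones.\<close>

lemma shortest_negative_cycle_exchange:
  assumes neg: "negative_cycle \<alpha> \<beta> A ps"
    and min: "\<And>qs. length qs < length ps \<Longrightarrow> \<not> negative_cycle \<alpha> \<beta> A qs"
    and ps: "ps = xs @ (a, b) # ys @ (c, d) # zs"
    and s: "s = walk_start zs (fst (hd ps))" and t: "t = walk_start ys c"
  shows "\<alpha> a b + \<alpha> c d < \<alpha> a d + \<alpha> c b" and "\<beta> b t + \<beta> d s < \<beta> b s + \<beta> d t"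
proof -
  \<comment> \<open>The \<beta>-steps leave \<open>b\<close> for \<open>t\<close> and
    \<open>d\<close> for \<open>s\<close>; \<open>r\<close> is the vertex where the whole cycle
    closes.\<close>
  define r where "r = fst (hd ps)"
  have r: "r = walk_start xs a"
    by (cases xs) (auto simp: r_def ps)
  have A: "set ps \<subseteq> A \<times> A" and w: "walk_weight \<alpha> \<beta> ps r < 0"
    using neg by (auto simp: negative_cycle_def r_def)
  have cyc: "0 \<le> walk_weight \<alpha> \<beta> qs v"
    if "length qs < length ps" "set qs \<subseteq> A \<times> A" "qs \<noteq> []" "walk_start qs v' = v" for qs v v'
    using min[OF that(1)] that(2-) by (auto simp: negative_cycle_def walk_start_def)
  have s': "s = walk_start zs r"
    by (simp add: s r_def)
  have "0 \<le> walk_weight \<alpha> \<beta> (xs @ (a, d) # zs) r"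
    by (rule cyc[of _ a]) (use A in \<open>auto simp: ps r\<close>)
  moreover have "0 \<le> walk_weight \<alpha> \<beta> (ys @ [(c, b)]) t"
    by (rule cyc[of _ c]) (use A in \<open>auto simp: ps t\<close>)
  ultimately show "\<alpha> a b + \<alpha> c d < \<alpha> a d + \<alpha> c b"
    using w by (simp add: ps walk_weight_append s'[symmetric] t[symmetric])
  have "0 \<le> walk_weight \<alpha> \<beta> (xs @ (a, b) # zs) r"
    by (rule cyc[of _ a]) (use A in \<open>auto simp: ps r\<close>)
  moreover have "0 \<le> walk_weight \<alpha> \<beta> (ys @ [(c, d)]) t"
    by (rule cyc[of _ c]) (use A in \<open>auto simp: ps t\<close>)
  ultimately show "\<beta> b t + \<beta> d s < \<beta> b s + \<beta> d t"
    using w by (simp add: ps walk_weight_append s'[symmetric] t[symmetric])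
qed

text \<open>The exchange lemma is applied to a negative cycle with the fewest pairs. Assumption
  \<open>pos\<close> rules out a cycle with a single pair.\<close>

lemma infeasible_imp_strict_exchange:
  fixes \<alpha> \<beta> :: "'a \<Rightarrow> 'a \<Rightarrow> real"
  assumes "finite A" and \<alpha>0: "\<And>v. \<alpha> v v = 0" and \<beta>0: "\<And>v. \<beta> v v = 0"
    and pos: "\<And>u v. u \<in> A \<Longrightarrow> v \<in> A \<Longrightarrow> 0 \<le> \<alpha> u v + \<beta> v u"
    and infeasible: "\<not> (\<exists>y. \<forall>u\<in>A. \<forall>v\<in>A. y u - y v \<le> \<alpha> u v \<and> y u - y v \<le> \<beta> u v)"
  obtains k :: nat and i j where "2 \<le> k" "\<And>m. m < k \<Longrightarrow> i m \<in> A \<and> j m \<in> A"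
    "\<And>m l. m < k \<Longrightarrow> l < k \<Longrightarrow> m \<noteq> l \<Longrightarrow> \<alpha> (i m) (j m) + \<alpha> (i l) (j l) < \<alpha> (i m) (j l) + \<alpha> (i l) (j m)"
    "\<And>m l. m < k \<Longrightarrow> l < k \<Longrightarrow> m \<noteq> l \<Longrightarrow>
       \<beta> (j m) (i (Suc m mod k)) + \<beta> (j l) (i (Suc l mod k)) <
       \<beta> (j m) (i (Suc l mod k)) + \<beta> (j l) (i (Suc m mod k))"
proof -
  obtain ps0 where "negative_cycle \<alpha> \<beta> A ps0"
    using potential_exists[of A \<alpha> \<beta>, OF assms(1) _ \<alpha>0 \<beta>0] infeasible by metis
  then obtain ps where neg: "negative_cycle \<alpha> \<beta> A ps"
    and min: "\<And>qs. length qs < length ps \<Longrightarrow> \<not> negative_cycle \<alpha> \<beta> A qs"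
    using ex_has_least_nat[of "negative_cycle \<alpha> \<beta> A" ps0 length] by (metis not_le)
  define k where "k = length ps"
  define i j where "i m = fst (ps ! m)" and "j m = snd (ps ! m)" for m
  have ps: "set ps \<subseteq> A \<times> A" "ps \<noteq> []" "walk_weight \<alpha> \<beta> ps (fst (hd ps)) < 0"
    using neg by (auto simp: negative_cycle_def)
  have ij: "i m \<in> A \<and> j m \<in> A" if "m < k" for m
  proof -
    have "ps ! m \<in> A \<times> A"
      using ps(1) that unfolding k_def by (meson nth_mem subsetD)
    then show ?thesis
      by (auto simp: i_def j_def)
  qed
  have "k \<noteq> 1"
  proof
    assume "k = 1"
    then obtain a b where ab: "ps = [(a, b)]"
      unfolding k_def by (metis One_nat_def length_0_conv length_Suc_conv prod.exhaust)
    show False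
      using ps pos[of a b] by (simp add: ab)
  qed
  then have k2: "2 \<le> k"
    using ps(2) unfolding k_def by (cases ps) (auto simp: Suc_le_eq)
  have *: "\<alpha> (i m) (j m) + \<alpha> (i l) (j l) < \<alpha> (i m) (j l) + \<alpha> (i l) (j m) \<and>
       \<beta> (j m) (i (Suc m mod k)) + \<beta> (j l) (i (Suc l mod k)) <
       \<beta> (j m) (i (Suc l mod k)) + \<beta> (j l) (i (Suc m mod k))" if "m < l" "l < k" for m l
  proof -
    define xs ys zs where "xs = take m ps" and "ys = take (l - Suc m) (drop (Suc m) ps)"
      and "zs = drop (Suc l) ps"
    have "drop (Suc m) ps = ys @ drop (l - Suc m) (drop (Suc m) ps)"
      unfolding ys_def by (simp only: append_take_drop_id)
    also have "drop (l - Suc m) (drop (Suc m) ps) = ps ! l # zs"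
      using that by (simp add: k_def zs_def Cons_nth_drop_Suc)
    finally have dec: "ps = xs @ (i m, j m) # ys @ (i l, j l) # zs"
      using that id_take_nth_drop[of m ps] by (simp add: i_def j_def xs_def k_def)
    \<comment> \<open>After the last pair the walk returns to the first vertex, which is what
      \<open>mod k\<close> encodes.\<close>
    have s: "walk_start zs (fst (hd ps)) = i (Suc l mod k)"
    proof (cases "Suc l = k")
      case True
      then show ?thesis
        using ps(2) by (simp add: zs_def k_def i_def hd_conv_nth)
    next
      case False
      then have "Suc l < k"
        using that by simp
      then show ?thesis
        by (simp add: zs_def k_def i_def walk_start_def hd_drop_conv_nth)
    qed
    have t: "walk_start ys (i l) = i (Suc m mod k)"
    proof (cases "Suc m = l")
      case True
      then show ?thesis
        using that by (simp add: ys_def)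
    next
      case False
      then have "Suc m < l"
        using that by simp
      then show ?thesis
        using that by (simp add: ys_def walk_start_def k_def i_def hd_drop_conv_nth)
    qed
    show ?thesis
      using shortest_negative_cycle_exchange[OF neg min dec s[symmetric] t[symmetric]] by simp
  qed
  show thesis
  proof (rule that[OF k2 ij])
    fix m l assume "m < k" "l < k" "m \<noteq> l"
    then show "\<alpha> (i m) (j m) + \<alpha> (i l) (j l) < \<alpha> (i m) (j l) + \<alpha> (i l) (j m)"
      using *[of m l] *[of l m] by (cases "m < l") auto
  next
    fix m l assume "m < k" "l < k" "m \<noteq> l"
    then show "\<beta> (j m) (i (Suc m mod k)) + \<beta> (j l) (i (Suc l mod k)) <
       \<beta> (j m) (i (Suc l mod k)) + \<beta> (j l) (i (Suc m mod k))"
      using *[of m l] *[of l m] by (cases "m < l") auto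
  qed
qed

subsection \<open>Splitting along two cyclic orders\<close>

text \<open>This is \<open>a\<^sub>S\<close> for the order whose positions are given by
  \<open>p\<close>.\<close>

definition inversion_cost :: "('a \<Rightarrow> nat) \<Rightarrow> 'a \<Rightarrow> 'a \<Rightarrow> real" where
  "inversion_cost p u v = (if p u < p v then 1 else 0)"

lemma inversion_cost_triangle:
  "inversion_cost p u w \<le> inversion_cost p u v + inversion_cost p v w"
  by (auto simp: inversion_cost_def)

text \<open>Expresses that the Minkowski sum fills the region cut out by the summed bounds, but for
  functions that are not normalised to sum zero; \<open>center\<close> restores the
  normalisation.\<close>

definition splits :: "'a set \<Rightarrow> ('a \<Rightarrow> 'a \<Rightarrow> real) \<Rightarrow> ('a \<Rightarrow> 'a \<Rightarrow> real) \<Rightarrow> bool" where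
  "splits A \<alpha> \<beta> \<longleftrightarrow> (\<forall>x. (\<forall>u\<in>A. \<forall>v\<in>A. x u - x v \<le> \<alpha> u v + \<beta> u v) \<longrightarrow>
     (\<exists>y z. (\<forall>u\<in>A. x u = y u + z u) \<and>
        (\<forall>u\<in>A. \<forall>v\<in>A. y u - y v \<le> \<alpha> u v \<and> z u - z v \<le> \<beta> u v)))"

text \<open>Moving the cut point changes both sides of the inequality equally. If \<open>b\<close>
  comes first, the terms ending in \<open>b\<close> vanish and the inequality says that
  \<open>a\<close> precedes \<open>d\<close> while \<open>c\<close> does not; this is the order
  \<open>b, a, d, c\<close>.\<close>

lemma cyc4_of_exchange:
  assumes "inversion_cost p a b + inversion_cost p c d < inversion_cost p a d + inversion_cost p c b"
    and "p a \<noteq> p b" "p c \<noteq> p d"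
  shows "cyc4 (p b) (p a) (p d) (p c)"
  using assms unfolding inversion_cost_def cyc4_iff by (auto split: if_splits)

lemma not_splits_imp_interlaced:
  assumes "finite A" and p: "inj_on p A" and q: "inj_on q A"
    and "\<not> splits A (inversion_cost p) (inversion_cost q)"
  shows "(\<exists>a\<in>A. \<exists>b\<in>A. \<exists>c\<in>A. \<exists>d\<in>A.
      cyc4 (p a) (p b) (p c) (p d) \<and> cyc4 (q c) (q b) (q a) (q d)) \<or>
    (\<exists>a\<in>A. \<exists>b\<in>A. \<exists>c\<in>A. \<exists>d\<in>A. \<exists>e\<in>A. \<exists>f\<in>A.
      cyc6 (p a) (p b) (p c) (p d) (p e) (p f) \<and> cyc6 (q a) (q d) (q e) (q b) (q c) (q f))"
proof -
  let ?\<alpha> = "inversion_cost p"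
  obtain x where x: "\<And>u v. u \<in> A \<Longrightarrow> v \<in> A \<Longrightarrow> x u - x v \<le> ?\<alpha> u v + inversion_cost q u v"
    and no: "\<not> (\<exists>y z. (\<forall>u\<in>A. x u = y u + z u) \<and>
        (\<forall>u\<in>A. \<forall>v\<in>A. y u - y v \<le> ?\<alpha> u v \<and> z u - z v \<le> inversion_cost q u v))"
    using assms(4) unfolding splits_def by blast
  \<comment> \<open>Eliminates \<open>z = x - y\<close>: the bound on \<open>z v - z u\<close>
    becomes an upper bound on \<open>y u - y v\<close>.\<close>
  define \<beta> where "\<beta> u v = inversion_cost q v u + x u - x v" for u v
  have infeasible: "\<not> (\<exists>y. \<forall>u\<in>A. \<forall>v\<in>A. y u - y v \<le> ?\<alpha> u v \<and> y u - y v \<le> \<beta> u v)"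
  proof
    assume "\<exists>y. \<forall>u\<in>A. \<forall>v\<in>A. y u - y v \<le> ?\<alpha> u v \<and> y u - y v \<le> \<beta> u v"
    then obtain y where y: "\<And>u v. u \<in> A \<Longrightarrow> v \<in> A \<Longrightarrow> y u - y v \<le> ?\<alpha> u v \<and> y u - y v \<le> \<beta> u v"
      by blast
    have "(x u - y u) - (x v - y v) \<le> inversion_cost q u v" if "u \<in> A" "v \<in> A" for u v
      using y[OF that(2,1)] by (simp add: \<beta>_def)
    then have "\<exists>y z. (\<forall>u\<in>A. x u = y u + z u) \<and>
        (\<forall>u\<in>A. \<forall>v\<in>A. y u - y v \<le> ?\<alpha> u v \<and> z u - z v \<le> inversion_cost q u v)"
      using y by (intro exI[of _ y] exI[of _ "\<lambda>u. x u - y u"]) auto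
    then show False
      using no by blast
  qed
  have nonneg: "0 \<le> ?\<alpha> u v + \<beta> v u" if "u \<in> A" "v \<in> A" for u v
    using x[OF that] by (simp add: \<beta>_def)
  obtain k i j where k: "2 \<le> k" and A: "\<And>m. m < k \<Longrightarrow> i m \<in> A \<and> j m \<in> A"
    and E: "\<And>m l. m < k \<Longrightarrow> l < k \<Longrightarrow> m \<noteq> l \<Longrightarrow>
      ?\<alpha> (i m) (j m) + ?\<alpha> (i l) (j l) < ?\<alpha> (i m) (j l) + ?\<alpha> (i l) (j m)"
    and F: "\<And>m l. m < k \<Longrightarrow> l < k \<Longrightarrow> m \<noteq> l \<Longrightarrow>
       \<beta> (j m) (i (Suc m mod k)) + \<beta> (j l) (i (Suc l mod k)) <
       \<beta> (j m) (i (Suc l mod k)) + \<beta> (j l) (i (Suc m mod k))"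
    using infeasible_imp_strict_exchange[of A ?\<alpha> \<beta>, OF assms(1) _ _ nonneg infeasible]
    by (auto simp: inversion_cost_def \<beta>_def)
  define \<sigma> \<tau> where "\<sigma> m = Suc m mod k" and "\<tau> m = (if m = 0 then k - 1 else m - 1)" for m
  have \<sigma>: "\<sigma> m \<in> {..<k} \<and> \<tau> m \<in> {..<k} \<and> \<sigma> (\<tau> m) = m \<and> \<tau> (\<sigma> m) = m \<and> \<sigma> m \<noteq> m"
    if "m \<in> {..<k}" for m
    using that k by (cases "Suc m = k") (auto simp: \<sigma>_def \<tau>_def mod_if)
  \<comment> \<open>The values of \<open>x\<close> cancel, since an exchange keeps the sources and
    the targets.\<close>
  have F': "inversion_cost q (i (\<sigma> m)) (j m) + inversion_cost q (i (\<sigma> l)) (j l) <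
      inversion_cost q (i (\<sigma> m)) (j l) + inversion_cost q (i (\<sigma> l)) (j m)"
    if "m < k" "l < k" "m \<noteq> l" for m l
    using F[OF that] by (simp add: \<beta>_def \<sigma>_def)
  \<comment> \<open>If \<open>i m = j m\<close>, then the exchange of the two \<open>\<beta>\<close>-steps at this vertex contradicts the
    triangle inequality.\<close>
  have ne: "i m \<noteq> j m" if "m < k" for m
  proof
    assume eq: "i m = j m"
    have t: "\<tau> m < k" "\<sigma> (\<tau> m) = m" "\<tau> m \<noteq> m"
      using \<sigma>[of m] that by auto
    show False
      using F'[OF that t(1)] t eq inversion_cost_triangle[of q "i (\<sigma> m)" "j (\<tau> m)" "i m"]
      by (auto simp: inversion_cost_def split: if_splits)
  qed
  have S: "cyc4 (p (j m)) (p (i m)) (p (j l)) (p (i l))" if "m < k" "l < k" "m \<noteq> l" for m l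
  proof (rule cyc4_of_exchange[OF E[OF that]])
    show "p (i m) \<noteq> p (j m)" "p (i l) \<noteq> p (j l)"
      using p ne that A by (auto dest: inj_onD)
  qed
  \<comment> \<open>The order of the pairs \<open>m\<close> and \<open>\<sigma> m\<close> in
    \<open>p\<close> already keeps these two vertices apart.\<close>
  have ne': "i (\<sigma> m) \<noteq> j m" if "m < k" for m
  proof -
    have "cyc4 (p (j m)) (p (i m)) (p (j (\<sigma> m))) (p (i (\<sigma> m)))"
      using S[of m "\<sigma> m"] \<sigma>[of m] that by simp
    then show ?thesis
      by (auto simp: cyc4_iff)
  qed
  have T: "cyc4 (q (j m)) (q (i (\<sigma> m))) (q (j l)) (q (i (\<sigma> l)))"
    if "m < k" "l < k" "m \<noteq> l" for m l
  proof (rule cyc4_of_exchange[OF F'[OF that]])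
    have "\<sigma> m < k" "\<sigma> l < k"
      using \<sigma> that by auto
    then show "q (i (\<sigma> m)) \<noteq> q (j m)" "q (i (\<sigma> l)) \<noteq> q (j l)"
      using q ne' that A by (metis inj_onD)+
  qed
  show ?thesis
  proof (rule interlaced_of_alternating[of "{..<k}" \<sigma> \<tau> i A j p q, OF \<sigma>])
    show "{..<k} \<noteq> {}"
      using k by (simp add: lessThan_empty_iff)
  qed (use A S T in auto)
qed

section \<open>Interlaced orders do not split\<close>

text \<open>Coboundaries are absorbed by shifting \<open>y\<close> by \<open>g\<close>,
  \<open>z\<close> by \<open>h\<close>, and \<open>x\<close> by both.\<close>

lemma splits_gauge:
  assumes "splits A \<alpha> \<beta>"
    and \<alpha>: "\<And>u v. u \<in> A \<Longrightarrow> v \<in> A \<Longrightarrow> \<alpha> u v = \<alpha>' u v + g u - g v"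
    and \<beta>: "\<And>u v. u \<in> A \<Longrightarrow> v \<in> A \<Longrightarrow> \<beta> u v = \<beta>' u v + h u - h v"
  shows "splits A \<alpha>' \<beta>'"
  unfolding splits_def
proof (intro allI impI)
  fix x assume x: "\<forall>u\<in>A. \<forall>v\<in>A. x u - x v \<le> \<alpha>' u v + \<beta>' u v"
  have "(x u + g u + h u) - (x v + g v + h v) \<le> \<alpha> u v + \<beta> u v" if "u \<in> A" "v \<in> A" for u v
    using bspec[OF bspec[OF x that(1)] that(2)] \<alpha>[OF that] \<beta>[OF that] by linarith
  then obtain y z where y: "\<And>u. u \<in> A \<Longrightarrow> x u + g u + h u = y u + z u"
    "\<And>u v. u \<in> A \<Longrightarrow> v \<in> A \<Longrightarrow> y u - y v \<le> \<alpha> u v \<and> z u - z v \<le> \<beta> u v"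
    using assms(1)[unfolded splits_def, THEN spec, of "\<lambda>u. x u + g u + h u"] by blast
  show "\<exists>y z. (\<forall>u\<in>A. x u = y u + z u) \<and>
        (\<forall>u\<in>A. \<forall>v\<in>A. y u - y v \<le> \<alpha>' u v \<and> z u - z v \<le> \<beta>' u v)"
  proof (intro exI conjI ballI)
    fix u v assume uv: "u \<in> A" "v \<in> A"
    show "y u - g u - (y v - g v) \<le> \<alpha>' u v" "z u - h u - (z v - h v) \<le> \<beta>' u v"
      using y(2)[OF uv] \<alpha>[OF uv] \<beta>[OF uv] by linarith+
  next
    fix u assume "u \<in> A"
    show "x u = y u - g u + (z u - h u)"
      using y(1)[OF \<open>u \<in> A\<close>] by linarith
  qed
qed

text \<open>Cutting a cyclic order at another point changes the costs by a coboundary.\<close>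

lemma cut_cyclic_order:
  assumes "finite A"
  obtains p' g where
    "\<And>u v. u \<in> A \<Longrightarrow> v \<in> A \<Longrightarrow> inversion_cost p u v = inversion_cost p' u v + g u - g v"
    "\<And>b c d. b \<in> A \<Longrightarrow> c \<in> A \<Longrightarrow> d \<in> A \<Longrightarrow> cyc4 (p a) (p b) (p c) (p d) \<Longrightarrow>
       p' a < p' b \<and> p' b < p' c \<and> p' c < p' d"
    "\<And>b c d e f. b \<in> A \<Longrightarrow> c \<in> A \<Longrightarrow> d \<in> A \<Longrightarrow> e \<in> A \<Longrightarrow> f \<in> A \<Longrightarrow>
       cyc6 (p a) (p b) (p c) (p d) (p e) (p f) \<Longrightarrow>
       p' a < p' b \<and> p' b < p' c \<and> p' c < p' d \<and> p' d < p' e \<and> p' e < p' f"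
proof -
  obtain N where N: "\<And>u. u \<in> A \<Longrightarrow> p u < N" and a: "p a < N"
    using finite_nat_set_iff_bounded[of "p ` insert a A"] assms by auto
  \<comment> \<open>Elements before \<open>a\<close> are moved behind all others by adding
    \<open>N\<close>, and \<open>g\<close> marks the moved ones.\<close>
  define p' where "p' u = (if p u < p a then p u + N else p u)" for u
  define g where "g u = (if p u < p a then 1 else 0 :: real)" for u
  have 1: "inversion_cost p u v = inversion_cost p' u v + g u - g v" if "u \<in> A" "v \<in> A" for u v
    using N[OF that(1)] N[OF that(2)] by (auto simp: inversion_cost_def p'_def g_def)
  have 2: "p' a < p' b \<and> p' b < p' c \<and> p' c < p' d"
    if A: "b \<in> A" "c \<in> A" "d \<in> A" and c: "cyc4 (p a) (p b) (p c) (p d)" for b c d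
    using c a N[OF A(1)] N[OF A(2)] N[OF A(3)] unfolding cyc4_iff p'_def
    by (elim disjE conjE) simp_all
  have 3: "p' a < p' b \<and> p' b < p' c \<and> p' c < p' d \<and> p' d < p' e \<and> p' e < p' f"
    if "b \<in> A" "c \<in> A" "d \<in> A" "e \<in> A" "f \<in> A"
      and c: "cyc6 (p a) (p b) (p c) (p d) (p e) (p f)" for b c d e f
    using 2[of b c d] 2[of d e f] that by (simp add: cyc6_iff_cyc4)
  show thesis
    using that[of p' g, OF 1 2 3] by blast
qed

text \<open>The indicator function of a set \<open>D\<close> obeys the bounds for the sum of the costs
  as soon as \<open>D\<close> is closed downwards in the intersection of the two linear orders.\<close>

lemma splits_indicator:
  assumes "splits A (inversion_cost p) (inversion_cost q)"
    and D: "\<And>u v. u \<in> A \<Longrightarrow> v \<in> A \<Longrightarrow> u \<in> D \<Longrightarrow> p v \<le> p u \<Longrightarrow> q v \<le> q u \<Longrightarrow> v \<in> D"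
  obtains y z where "\<And>u. u \<in> A \<Longrightarrow> y u + z u = indicat_real D u"
    "\<And>u v. u \<in> A \<Longrightarrow> v \<in> A \<Longrightarrow> p v \<le> p u \<Longrightarrow> y u \<le> y v"
    "\<And>u v. u \<in> A \<Longrightarrow> v \<in> A \<Longrightarrow> q v \<le> q u \<Longrightarrow> z u \<le> z v"
proof -
  have "indicator D u - indicator D v \<le> inversion_cost p u v + inversion_cost q u v"
    if "u \<in> A" "v \<in> A" for u v
    using D[OF that] by (auto simp: inversion_cost_def indicator_def)
  then obtain y z where yz: "\<And>u. u \<in> A \<Longrightarrow> indicator D u = y u + z u"
    "\<And>u v. u \<in> A \<Longrightarrow> v \<in> A \<Longrightarrow> y u - y v \<le> inversion_cost p u v \<and> z u - z v \<le> inversion_cost q u v"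
    using assms(1)[unfolded splits_def, THEN spec, of "indicator D"] by blast
  show thesis
  proof (rule that[of y z])
    fix u v assume uv: "u \<in> A" "v \<in> A"
    show "y u \<le> y v" if "p v \<le> p u"
      using yz(2)[OF uv] that by (simp add: inversion_cost_def)
    show "z u \<le> z v" if "q v \<le> q u"
      using yz(2)[OF uv] that by (simp add: inversion_cost_def)
  qed (use yz in simp)
qed

text \<open>After the cuts, the down-set \<open>D\<close> generated by \<open>b\<close> contains
  none of \<open>a\<close>, \<open>c\<close>, \<open>d\<close>. Each order pairs \<open>b\<close>
  and \<open>d\<close> with earlier elements among \<open>a\<close> and \<open>c\<close>, so the
  indicator sums to at most as much over the former as over the latter:
  \<open>1 \<le> 0\<close>.\<close>

lemma four_interlaced_imp_not_splits:
  assumes "finite A" and A: "a \<in> A" "b \<in> A" "c \<in> A" "d \<in> A"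
    and p: "cyc4 (p a) (p b) (p c) (p d)" and q: "cyc4 (q c) (q b) (q a) (q d)"
  shows "\<not> splits A (inversion_cost p) (inversion_cost q)"
proof
  assume spl: "splits A (inversion_cost p) (inversion_cost q)"
  obtain p' g where p': "\<And>u v. u \<in> A \<Longrightarrow> v \<in> A \<Longrightarrow> inversion_cost p u v = inversion_cost p' u v + g u - g v"
    "p' a < p' b \<and> p' b < p' c \<and> p' c < p' d"
    using cut_cyclic_order[OF assms(1), of p a] p A by metis
  obtain q' h where q': "\<And>u v. u \<in> A \<Longrightarrow> v \<in> A \<Longrightarrow> inversion_cost q u v = inversion_cost q' u v + h u - h v"
    "q' c < q' b \<and> q' b < q' a \<and> q' a < q' d"
    using cut_cyclic_order[OF assms(1), of q c] q A by metis
  define D where "D = {v. p' v \<le> p' b \<and> q' v \<le> q' b}"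
  obtain y z where yz: "\<And>u. u \<in> A \<Longrightarrow> y u + z u = indicat_real D u"
    "\<And>u v. u \<in> A \<Longrightarrow> v \<in> A \<Longrightarrow> p' v \<le> p' u \<Longrightarrow> y u \<le> y v"
    "\<And>u v. u \<in> A \<Longrightarrow> v \<in> A \<Longrightarrow> q' v \<le> q' u \<Longrightarrow> z u \<le> z v"
    by (rule splits_indicator[OF splits_gauge[OF spl p'(1) q'(1)], of D]) (auto simp: D_def)
  have "y b \<le> y a" "y d \<le> y c" "z b \<le> z c" "z d \<le> z a"
    using yz(2,3) A p'(2) q'(2) by auto
  moreover have "y a + z a = 0" "y b + z b = 1" "y c + z c = 0" "y d + z d = 0"
    using yz(1) A p'(2) q'(2) by (auto simp: D_def indicator_def)
  ultimately show False
    by linarith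
qed

text \<open>The down-set \<open>D\<close> generated by \<open>b\<close> and \<open>d\<close> also
  contains \<open>a\<close>, but not \<open>c\<close>, \<open>e\<close>, \<open>f\<close>. Each
  order pairs \<open>b\<close>, \<open>d\<close>, \<open>f\<close> with earlier elements among
  \<open>a\<close>, \<open>c\<close>, \<open>e\<close>; summing as for four elements yields
  \<open>2 \<le> 1\<close>.\<close>

lemma six_interlaced_imp_not_splits:
  assumes "finite A" and A: "a \<in> A" "b \<in> A" "c \<in> A" "d \<in> A" "e \<in> A" "f \<in> A"
    and p: "cyc6 (p a) (p b) (p c) (p d) (p e) (p f)" and q: "cyc6 (q a) (q d) (q e) (q b) (q c) (q f)"
  shows "\<not> splits A (inversion_cost p) (inversion_cost q)"
proof
  assume spl: "splits A (inversion_cost p) (inversion_cost q)"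
  obtain p' g where p': "\<And>u v. u \<in> A \<Longrightarrow> v \<in> A \<Longrightarrow> inversion_cost p u v = inversion_cost p' u v + g u - g v"
    "p' a < p' b \<and> p' b < p' c \<and> p' c < p' d \<and> p' d < p' e \<and> p' e < p' f"
    using cut_cyclic_order[OF assms(1), of p a] p A by metis
  obtain q' h where q': "\<And>u v. u \<in> A \<Longrightarrow> v \<in> A \<Longrightarrow> inversion_cost q u v = inversion_cost q' u v + h u - h v"
    "q' a < q' d \<and> q' d < q' e \<and> q' e < q' b \<and> q' b < q' c \<and> q' c < q' f"
    using cut_cyclic_order[OF assms(1), of q a] q A by metis
  define D where "D = {v. p' v \<le> p' b \<and> q' v \<le> q' b \<or> p' v \<le> p' d \<and> q' v \<le> q' d}"
  obtain y z where yz: "\<And>u. u \<in> A \<Longrightarrow> y u + z u = indicat_real D u"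
    "\<And>u v. u \<in> A \<Longrightarrow> v \<in> A \<Longrightarrow> p' v \<le> p' u \<Longrightarrow> y u \<le> y v"
    "\<And>u v. u \<in> A \<Longrightarrow> v \<in> A \<Longrightarrow> q' v \<le> q' u \<Longrightarrow> z u \<le> z v"
    by (rule splits_indicator[OF splits_gauge[OF spl p'(1) q'(1)], of D]) (auto simp: D_def)
  have "y b \<le> y a" "y d \<le> y c" "y f \<le> y e" "z d \<le> z a" "z b \<le> z e" "z f \<le> z c"
    using yz(2,3) A p'(2) q'(2) by auto
  moreover have "y a + z a = 1" "y b + z b = 1" "y c + z c = 0" "y d + z d = 1"
    "y e + z e = 0" "y f + z f = 0"
    using yz(1) A p'(2) q'(2) by (auto simp: D_def indicator_def)
  ultimately show False
    by linarith
qed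

subsection \<open>Nondegenerate partitions as lists\<close>

abbreviation singletons :: "'a list \<Rightarrow> 'a set list" where
  "singletons \<equiv> map (\<lambda>x. {x})"

lemma nondegenerate_imp_singletons:
  assumes S: "ordered_set_partition A S" "nondegenerate S"
  obtains xs where "distinct xs" "set xs = A" "S = singletons xs"
proof -
  define xs where "xs = map the_elem S"
  have sing: "{the_elem B} = B" if "B \<in> set S" for B
    using S(2) that unfolding nondegenerate_def by (metis is_singleton_the_elem)
  have eq: "S = singletons xs"
    unfolding xs_def using sing by (simp add: map_idI)
  have "set xs = A"
    using S(1) unfolding ordered_set_partition_def by (subst (asm) eq) auto
  moreover have "distinct xs"
    unfolding distinct_conv_nth
  proof (intro allI impI)
    fix k l assume kl: "k < length xs" "l < length xs" "k \<noteq> l"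
    then have "S ! k \<inter> S ! l = {}"
      using S(1) unfolding ordered_set_partition_def by (simp add: xs_def)
    then show "xs ! k \<noteq> xs ! l"
      using kl by (subst (asm) (1 2) eq) auto
  qed
  ultimately show thesis
    using that eq by blast
qed

lemma ordered_set_partition_singletons:
  assumes "distinct xs"
  shows "ordered_set_partition (set xs) (singletons xs)" "nondegenerate (singletons xs)"
  using assms by (auto simp: ordered_set_partition_def nondegenerate_def nth_eq_iff_index_eq)

lemma osp_restrict_singletons:
  "osp_restrict (singletons xs) I = singletons (filter (\<lambda>x. x \<in> I) xs)"
  by (induction xs) (auto simp: osp_restrict_def)

locale list_positions =
  fixes xs :: "'a list" and p :: "'a \<Rightarrow> nat"
  assumes dist: "distinct xs" and pos: "k < length xs \<Longrightarrow> p (xs ! k) = k"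
begin

lemma inj_on_pos: "inj_on p (set xs)"
  by (rule inj_onI) (metis in_set_conv_nth pos)

lemma sorted_pos: "sorted_wrt (\<lambda>x y. p x < p y) xs"
  by (simp add: sorted_wrt_iff_nth_less pos)

text \<open>A restriction lists its elements by increasing position, and a strictly increasing list
  is determined by its set. So it is a rotation of \<open>ys\<close> exactly if some rotation of
  \<open>ys\<close> is sorted by position and no element is missing.\<close>

lemma cyclic_eq_restrict_iff:
  assumes ys: "distinct ys" "ys \<noteq> []"
  shows "cyclic_eq (osp_restrict (singletons xs) (set ys)) (singletons ys) \<longleftrightarrow>
    set ys \<subseteq> set xs \<and> (\<exists>k<length ys. sorted_wrt (<) (rotate k (map p ys)))"
proof -
  define F where "F = filter (\<lambda>x. x \<in> set ys) xs"
  have F: "distinct F" "sorted_wrt (<) (map p F)" "set F = set xs \<inter> set ys"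
    using dist sorted_pos by (auto simp: F_def sorted_wrt_filter sorted_wrt_map)
  have "cyclic_eq (osp_restrict (singletons xs) (set ys)) (singletons ys) \<longleftrightarrow>
      (\<exists>k. rotate k F = ys)"
    by (simp add: cyclic_eq_def osp_restrict_singletons F_def rotate_map inj_map_eq_map)
  also have "\<dots> \<longleftrightarrow> set ys \<subseteq> set xs \<and> (\<exists>k<length ys. sorted_wrt (<) (rotate k (map p ys)))"
  proof (intro iffI conjI)
    assume "\<exists>k. rotate k F = ys"
    then obtain k where k: "rotate k F = ys"
      by blast
    show "set ys \<subseteq> set xs"
      using F(3) k by (metis inf_le1 set_rotate)
    have len: "length F = length ys"
      using k by auto
    \<comment> \<open>The rotation inverse to \<open>k\<close>; the outer \<open>mod\<close> matters
      when \<open>length ys\<close> divides \<open>k\<close>.\<close>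
    define r where "r = (length ys - k mod length ys) mod length ys"
    have "rotate r ys = rotate (r + k) F"
      using k rotate_rotate by metis
    also have "\<dots> = rotate ((r + k) mod length F) F"
      by (rule rotate_conv_mod)
    also have "(r + k) mod length F = 0"
    proof -
      have "(r + k) mod length ys = (length ys - k mod length ys + k mod length ys) mod length ys"
        unfolding r_def by (metis mod_add_eq mod_mod_trivial)
      also have "\<dots> = 0"
        using ys(2) by simp
      finally show ?thesis
        by (simp add: len)
    qed
    finally have "rotate r ys = F"
      by simp
    then show "\<exists>k<length ys. sorted_wrt (<) (rotate k (map p ys))"
      using F(2) ys(2) by (intro exI[of _ r]) (auto simp: rotate_map r_def)
  next
    assume R: "set ys \<subseteq> set xs \<and> (\<exists>k<length ys. sorted_wrt (<) (rotate k (map p ys)))"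
    then obtain k where k: "k < length ys" "sorted_wrt (<) (rotate k (map p ys))"
      by blast
    have "map p F = map p (rotate k ys)"
    proof (rule strict_sorted_equal)
      show "sorted_wrt (<) (map p (rotate k ys))"
        using k(2) by (simp add: rotate_map)
      show "sorted_wrt (<) (map p F)"
        by (rule F(2))
      show "set (map p F) = set (map p (rotate k ys))"
        using F(3) R by auto
    qed
    then have "F = rotate k ys"
      by (rule map_inj_on) (rule inj_on_subset[OF inj_on_pos], use F(3) R in auto)
    then have "rotate (length ys - k) F = ys"
      using k(1) by (simp add: rotate_rotate)
    then show "\<exists>k. rotate k F = ys"
      by blast
  qed
  finally show ?thesis .
qed

lemma cyclic_eq_restrict4_iff:
  assumes "distinct [a, b, c, d]"
  shows "cyclic_eq (osp_restrict (singletons xs) {a, b, c, d}) [{a}, {b}, {c}, {d}] \<longleftrightarrow>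
    {a, b, c, d} \<subseteq> set xs \<and> cyc4 (p a) (p b) (p c) (p d)"
proof -
  have "length [a, b, c, d] = 4"
    by simp
  then show ?thesis
    using cyclic_eq_restrict_iff[OF assms list.distinct(2)] unfolding cyc4_def by (simp only: list.set list.map)
qed

lemma cyclic_eq_restrict6_iff:
  assumes "distinct [a, b, c, d, e, f]"
  shows "cyclic_eq (osp_restrict (singletons xs) {a, b, c, d, e, f}) [{a}, {b}, {c}, {d}, {e}, {f}] \<longleftrightarrow>
    {a, b, c, d, e, f} \<subseteq> set xs \<and> cyc6 (p a) (p b) (p c) (p d) (p e) (p f)"
proof -
  have "length [a, b, c, d, e, f] = 6"
    by simp
  then show ?thesis
    using cyclic_eq_restrict_iff[OF assms list.distinct(2)] unfolding cyc6_def by (simp only: list.set list.map)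
qed

end

lemma cyc4_imp_distinct: "cyc4 (p a) (p b) (p c) (p d) \<Longrightarrow> distinct [a, b, c, d]"
  unfolding cyc4_iff by (elim disjE conjE) auto

lemma cyc6_imp_distinct: "cyc6 (p a) (p b) (p c) (p d) (p e) (p f) \<Longrightarrow> distinct [a, b, c, d, e, f]"
  unfolding cyc6_iff by (elim disjE conjE) auto

lemma list_positions_exists:
  assumes "distinct xs"
  obtains p where "list_positions xs p"
proof -
  have "inj_on ((!) xs) {..<length xs}"
    using assms by (simp add: inj_on_nth)
  then have "list_positions xs (inv_into {..<length xs} ((!) xs))"
    using assms by unfold_locales (simp_all add: inv_into_f_f)
  then show thesis
    by (rule that)
qed

lemma four_interlaced_iff:
  assumes "list_positions xs p" "list_positions ys q" and eq: "set xs = A" "set ys = A"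
  shows "four_interlaced (singletons xs) (singletons ys) \<longleftrightarrow>
    (\<exists>a\<in>A. \<exists>b\<in>A. \<exists>c\<in>A. \<exists>d\<in>A. cyc4 (p a) (p b) (p c) (p d) \<and> cyc4 (q c) (q b) (q a) (q d))"
    (is "?L \<longleftrightarrow> ?R")
proof -
  interpret xs: list_positions xs p by fact
  interpret ys: list_positions ys q by fact
  have set: "{a, b, c, d} = {c, b, a, d}" for a b c d :: 'a
    by auto
  have iff: "cyclic_eq (osp_restrict (singletons xs) {a, b, c, d}) [{a}, {b}, {c}, {d}] \<longleftrightarrow>
      {a, b, c, d} \<subseteq> A \<and> cyc4 (p a) (p b) (p c) (p d)"
    "cyclic_eq (osp_restrict (singletons ys) {a, b, c, d}) [{c}, {b}, {a}, {d}] \<longleftrightarrow>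
      {a, b, c, d} \<subseteq> A \<and> cyc4 (q c) (q b) (q a) (q d)"
    if d: "distinct [a, b, c, d]" for a b c d :: 'a
  proof -
    have d': "distinct [c, b, a, d]"
      using d by auto
    show "cyclic_eq (osp_restrict (singletons xs) {a, b, c, d}) [{a}, {b}, {c}, {d}] \<longleftrightarrow>
      {a, b, c, d} \<subseteq> A \<and> cyc4 (p a) (p b) (p c) (p d)"
      using xs.cyclic_eq_restrict4_iff[OF d] eq by simp
    show "cyclic_eq (osp_restrict (singletons ys) {a, b, c, d}) [{c}, {b}, {a}, {d}] \<longleftrightarrow>
      {a, b, c, d} \<subseteq> A \<and> cyc4 (q c) (q b) (q a) (q d)"
      using ys.cyclic_eq_restrict4_iff[OF d'] eq unfolding set[of a b c d] by simp
  qed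
  show ?thesis
  proof
    assume ?L
    then obtain a b c d where d: "distinct [a, b, c, d]"
      and *: "cyclic_eq (osp_restrict (singletons xs) {a, b, c, d}) [{a}, {b}, {c}, {d}]"
        "cyclic_eq (osp_restrict (singletons ys) {a, b, c, d}) [{c}, {b}, {a}, {d}]"
      unfolding four_interlaced_def by (elim exE conjE) (rule that)
    then have "a \<in> A" "b \<in> A" "c \<in> A" "d \<in> A"
      "cyc4 (p a) (p b) (p c) (p d)" "cyc4 (q c) (q b) (q a) (q d)"
      using iff[OF d] by auto
    then show ?R
      by (intro bexI conjI)
  next
    assume ?R
    then obtain a b c d where "a \<in> A" "b \<in> A" "c \<in> A" "d \<in> A"
      and p: "cyc4 (p a) (p b) (p c) (p d)" and q: "cyc4 (q c) (q b) (q a) (q d)"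
      by (elim bexE conjE) (rule that)
    then have A: "{a, b, c, d} \<subseteq> A"
      by blast
    have d: "distinct [a, b, c, d]"
      using p by (rule cyc4_imp_distinct)
    show ?L
      unfolding four_interlaced_def using d iff[OF d, THEN iffD2, OF conjI, OF A] p q
      by (intro exI conjI)
  qed
qed

lemma six_interlaced_iff:
  assumes "list_positions xs p" "list_positions ys q" and eq: "set xs = A" "set ys = A"
  shows "six_interlaced (singletons xs) (singletons ys) \<longleftrightarrow>
    (\<exists>a\<in>A. \<exists>b\<in>A. \<exists>c\<in>A. \<exists>d\<in>A. \<exists>e\<in>A. \<exists>f\<in>A.
      cyc6 (p a) (p b) (p c) (p d) (p e) (p f) \<and> cyc6 (q a) (q d) (q e) (q b) (q c) (q f))"
    (is "?L \<longleftrightarrow> ?R")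
proof -
  interpret xs: list_positions xs p by fact
  interpret ys: list_positions ys q by fact
  have set: "{a, b, c, d, e, f} = {c, d, a, b, e, f}" "{a, b, c, d, e, f} = {a, d, e, b, c, f}"
    for a b c d e f :: 'a
    by auto
  have iff: "cyclic_eq (osp_restrict (singletons xs) {a, b, c, d, e, f}) [{a}, {b}, {c}, {d}, {e}, {f}] \<longleftrightarrow>
      {a, b, c, d, e, f} \<subseteq> A \<and> cyc6 (p a) (p b) (p c) (p d) (p e) (p f)"
    "cyclic_eq (osp_restrict (singletons ys) {a, b, c, d, e, f}) [{c}, {d}, {a}, {b}, {e}, {f}] \<longleftrightarrow>
      {a, b, c, d, e, f} \<subseteq> A \<and> cyc6 (q c) (q d) (q a) (q b) (q e) (q f)"
    "cyclic_eq (osp_restrict (singletons ys) {a, b, c, d, e, f}) [{a}, {d}, {e}, {b}, {c}, {f}] \<longleftrightarrow>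
      {a, b, c, d, e, f} \<subseteq> A \<and> cyc6 (q a) (q d) (q e) (q b) (q c) (q f)"
    if d: "distinct [a, b, c, d, e, f]" for a b c d e f :: 'a
  proof -
    have d': "distinct [c, d, a, b, e, f]" "distinct [a, d, e, b, c, f]"
      using d by auto
    show "cyclic_eq (osp_restrict (singletons xs) {a, b, c, d, e, f}) [{a}, {b}, {c}, {d}, {e}, {f}] \<longleftrightarrow>
      {a, b, c, d, e, f} \<subseteq> A \<and> cyc6 (p a) (p b) (p c) (p d) (p e) (p f)"
      using xs.cyclic_eq_restrict6_iff[OF d] eq by simp
    show "cyclic_eq (osp_restrict (singletons ys) {a, b, c, d, e, f}) [{c}, {d}, {a}, {b}, {e}, {f}] \<longleftrightarrow>
      {a, b, c, d, e, f} \<subseteq> A \<and> cyc6 (q c) (q d) (q a) (q b) (q e) (q f)"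
      using ys.cyclic_eq_restrict6_iff[OF d'(1)] eq unfolding set(1)[of a b c d e f] by simp
    show "cyclic_eq (osp_restrict (singletons ys) {a, b, c, d, e, f}) [{a}, {d}, {e}, {b}, {c}, {f}] \<longleftrightarrow>
      {a, b, c, d, e, f} \<subseteq> A \<and> cyc6 (q a) (q d) (q e) (q b) (q c) (q f)"
      using ys.cyclic_eq_restrict6_iff[OF d'(2)] eq unfolding set(2)[of a b c d e f] by simp
  qed
  show ?thesis
  proof
    assume ?L
    then obtain a b c d e f where d: "distinct [a, b, c, d, e, f]"
      and *: "cyclic_eq (osp_restrict (singletons xs) {a, b, c, d, e, f}) [{a}, {b}, {c}, {d}, {e}, {f}]"
        "cyclic_eq (osp_restrict (singletons ys) {a, b, c, d, e, f}) [{c}, {d}, {a}, {b}, {e}, {f}] \<or>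
         cyclic_eq (osp_restrict (singletons ys) {a, b, c, d, e, f}) [{a}, {d}, {e}, {b}, {c}, {f}]"
      unfolding six_interlaced_def by (elim exE conjE) (rule that)
    have A: "a \<in> A" "b \<in> A" "c \<in> A" "d \<in> A" "e \<in> A" "f \<in> A"
      and p: "cyc6 (p a) (p b) (p c) (p d) (p e) (p f)"
      using *(1) iff(1)[OF d] by auto
    have "cyc6 (q c) (q d) (q a) (q b) (q e) (q f) \<or> cyc6 (q a) (q d) (q e) (q b) (q c) (q f)"
      using *(2) iff(2,3)[OF d] by auto
    then show ?R
    proof
      \<comment> \<open>The two patterns of six elements agree after a cyclic shift of the six labels.\<close>
      assume "cyc6 (q c) (q d) (q a) (q b) (q e) (q f)"
      then have "cyc6 (q b) (q e) (q f) (q c) (q d) (q a)"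
        unfolding cyc6_iff by (elim disjE conjE) simp_all
      moreover have "cyc6 (p b) (p c) (p d) (p e) (p f) (p a)"
        using p unfolding cyc6_iff by (elim disjE conjE) simp_all
      ultimately show ?R
        using A by (intro bexI conjI)
    next
      assume "cyc6 (q a) (q d) (q e) (q b) (q c) (q f)"
      then show ?R
        using A p by (intro bexI conjI)
    qed
  next
    assume ?R
    then obtain a b c d e f where "a \<in> A" "b \<in> A" "c \<in> A" "d \<in> A" "e \<in> A" "f \<in> A"
      and p: "cyc6 (p a) (p b) (p c) (p d) (p e) (p f)"
      and q: "cyc6 (q a) (q d) (q e) (q b) (q c) (q f)"
      by (elim bexE conjE) (rule that)
    then have A: "{a, b, c, d, e, f} \<subseteq> A"
      by blast
    have d: "distinct [a, b, c, d, e, f]"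
      using p by (rule cyc6_imp_distinct)
    show ?L
      unfolding six_interlaced_def using d iff(1,3)[OF d, THEN iffD2, OF conjI, OF A] p q
      by (intro exI conjI disjI2)
  qed
qed

subsection \<open>Compatibility\<close>

text \<open>Picks the sum-zero function among the translates of \<open>f\<close> by constants, which
  turns the functions in \<open>splits\<close> into points of \<open>sum_zero_space\<close>.\<close>

definition center :: "'n::finite set \<Rightarrow> ('n \<Rightarrow> real) \<Rightarrow> real ^ 'n" where
  "center A f = (\<chi> u. if u \<in> A then f u - (\<Sum>v\<in>A. f v) / real (card A) else 0)"

lemma center_in_sum_zero_space: "center A f \<in> sum_zero_space A"
proof -
  have "(\<Sum>u\<in>A. center A f $ u) = (\<Sum>u\<in>A. f u - (\<Sum>v\<in>A. f v) / real (card A))"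
    by (rule sum.cong) (auto simp: center_def)
  also have "\<dots> = 0"
    by (cases "A = {}") (simp_all add: sum_subtractf)
  finally show ?thesis
    by (simp add: sum_zero_space_def center_def)
qed

lemma center_diff: "u \<in> A \<Longrightarrow> v \<in> A \<Longrightarrow> center A f $ u - center A f $ v = f u - f v"
  by (simp add: center_def)

text \<open>The means of \<open>f\<close> and \<open>g\<close> add up to the mean of
  \<open>x\<close>, which is 0.\<close>

lemma sum_zero_space_center:
  assumes "x \<in> sum_zero_space A" and "\<And>u. u \<in> A \<Longrightarrow> x $ u = f u + g u"
  shows "x = center A f + center A g"
proof -
  have "(\<Sum>u\<in>A. f u) + (\<Sum>u\<in>A. g u) = (\<Sum>u\<in>A. x $ u)"
    using assms(2) by (simp add: sum.distrib)
  then have "(\<Sum>u\<in>A. f u) / real (card A) + (\<Sum>u\<in>A. g u) / real (card A) = 0"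
    using assms(1) by (simp add: sum_zero_space_def flip: add_divide_distrib)
  then show ?thesis
    using assms by (auto simp: vec_eq_iff center_def sum_zero_space_def)
qed

text \<open>Coordinates decrease along the list, by at most 1 in total, and this bounds every pair.
  Conversely, bounds for neighbours and for the two ends define the simplex.\<close>

lemma mem_alcoved_simplex_singletons_iff:
  fixes xs :: "'n::finite list"
  assumes "list_positions xs p"
  shows "x \<in> alcoved_simplex (set xs) (singletons xs) \<longleftrightarrow> x \<in> sum_zero_space (set xs) \<and>
    (\<forall>u\<in>set xs. \<forall>v\<in>set xs. x $ u - x $ v \<le> inversion_cost p u v)"
    (is "?L \<longleftrightarrow> ?R")
proof
  interpret list_positions xs p by fact
  have osp: "ordered_set_partition (set xs) (singletons xs)"
    using ordered_set_partition_singletons(1)[OF dist] .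
  have nth: "p u < length xs \<and> xs ! p u = u" if "u \<in> set xs" for u
    using that pos by (metis in_set_conv_nth)
  assume x: ?L
  have "x $ u - x $ v \<le> inversion_cost p u v" if uv: "u \<in> set xs" "v \<in> set xs" for u v
  proof (cases "p u < p v")
    case True
    then show ?thesis
      using alcoved_simplex_diff_le[OF osp x uv] by (simp add: inversion_cost_def)
  next
    case False
    then show ?thesis
      using alcoved_simplex_antimono[OF osp x, of "p v" "p u" v u] nth[OF uv(1)] nth[OF uv(2)]
      by (simp add: inversion_cost_def)
  qed
  then show ?R
    using x by (simp add: alcoved_simplex_def)
next
  interpret list_positions xs p by fact
  assume R: ?R
  have "x $ (xs ! Suc k) \<le> x $ (xs ! k)" if "Suc k < length xs" for k
  proof -
    have "x $ (xs ! Suc k) - x $ (xs ! k) \<le> inversion_cost p (xs ! Suc k) (xs ! k)"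
      using R that by simp
    then show ?thesis
      using pos[of k] pos[of "Suc k"] that by (simp add: inversion_cost_def)
  qed
  moreover have "x $ hd xs - x $ last xs \<le> 1" if "xs \<noteq> []"
  proof -
    have "x $ hd xs - x $ last xs \<le> inversion_cost p (hd xs) (last xs)"
      using R that by simp
    \<comment> \<open>Equality fails for a one-element list, where the cost is 0.\<close>
    also have "\<dots> \<le> 1"
      by (simp add: inversion_cost_def)
    finally show ?thesis .
  qed
  ultimately show ?L
    using R by (auto simp: alcoved_simplex_def last_map hd_map algebra_simps)
qed

lemma polytope_set_plus:
  assumes "polytope P" "polytope Q"
  shows "polytope (P + Q)"
proof -
  obtain V W where "finite V" "P = convex hull V" "finite W" "Q = convex hull W"
    using assms unfolding polytope_def by metis
  then show ?thesis
    unfolding polytope_def by (metis convex_hull_set_plus finite_set_plus)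
qed

text \<open>Sharpness of the bounds is what forces any bounds cutting out the Minkowski sum to
  dominate the summed costs.\<close>

lemma alcoved_simplex_singletons_bound_attained:
  fixes xs :: "'n::finite list"
  assumes "list_positions xs p" and uv: "u \<in> set xs" "v \<in> set xs"
  obtains x where "x \<in> alcoved_simplex (set xs) (singletons xs)"
    "x $ u - x $ v = inversion_cost p u v"
proof -
  \<comment> \<open>The indicator of the initial segment ending at \<open>u\<close>, or 0 when the
    bound itself is 0.\<close>
  define f where "f = (\<lambda>t. if p u < p v \<and> p t \<le> p u then 1 else 0 :: real)"
  have "center (set xs) f \<in> alcoved_simplex (set xs) (singletons xs)"
    unfolding mem_alcoved_simplex_singletons_iff[OF assms(1)]
    by (auto simp: center_in_sum_zero_space center_diff f_def inversion_cost_def)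
  moreover have "center (set xs) f $ u - center (set xs) f $ v = inversion_cost p u v"
    using uv by (simp add: center_diff f_def inversion_cost_def)
  ultimately show thesis
    by (rule that)
qed

text \<open>If the sum is alcoved, its bounds dominate the summed costs, so it contains every point
  that the summed costs allow; this is splitting. Conversely, splitting makes the summed costs
  themselves cut out the sum.\<close>

lemma compatible_singletons_iff_splits:
  fixes xs ys :: "'n::finite list"
  assumes xs: "list_positions xs p" and ys: "list_positions ys q"
    and eq: "set xs = A" "set ys = A"
  shows "compatible A (singletons xs) (singletons ys) \<longleftrightarrow>
    splits A (inversion_cost p) (inversion_cost q)"
proof -
  let ?P = "alcoved_simplex A (singletons xs)" and ?Q = "alcoved_simplex A (singletons ys)"
  have P: "x \<in> ?P \<longleftrightarrow> x \<in> sum_zero_space A \<and>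
      (\<forall>u\<in>A. \<forall>v\<in>A. x $ u - x $ v \<le> inversion_cost p u v)" for x
    using mem_alcoved_simplex_singletons_iff[OF xs] eq by simp
  have Q: "x \<in> ?Q \<longleftrightarrow> x \<in> sum_zero_space A \<and>
      (\<forall>u\<in>A. \<forall>v\<in>A. x $ u - x $ v \<le> inversion_cost q u v)" for x
    using mem_alcoved_simplex_singletons_iff[OF ys] eq by simp
  show ?thesis
  proof
    assume "compatible A (singletons xs) (singletons ys)"
    then obtain a where a: "?P + ?Q =
        {x \<in> sum_zero_space A. \<forall>i\<in>A. \<forall>j\<in>A. i \<noteq> j \<longrightarrow> x $ i - x $ j \<le> a i j}"
      unfolding compatible_def alcoved_def by (elim conjE exE) (rule that)
    have bound: "inversion_cost p u v + inversion_cost q u v \<le> a u v"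
      if uv: "u \<in> A" "v \<in> A" "u \<noteq> v" for u v
    proof -
      obtain y where y: "y \<in> ?P" "y $ u - y $ v = inversion_cost p u v"
        by (rule alcoved_simplex_singletons_bound_attained[OF xs, unfolded eq, OF uv(1,2)])
      obtain z where z: "z \<in> ?Q" "z $ u - z $ v = inversion_cost q u v"
        by (rule alcoved_simplex_singletons_bound_attained[OF ys, unfolded eq, OF uv(1,2)])
      have "y + z \<in> ?P + ?Q"
        using y(1) z(1) by (rule set_plus_intro)
      then have "(y + z) $ u - (y + z) $ v \<le> a u v"
        using a uv by auto
      then show ?thesis
        using y z by simp
    qed
    show "splits A (inversion_cost p) (inversion_cost q)"
      unfolding splits_def
    proof (intro allI impI)
      fix x assume x: "\<forall>u\<in>A. \<forall>v\<in>A. x u - x v \<le> inversion_cost p u v + inversion_cost q u v"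
      have "center A x $ u - center A x $ v \<le> a u v" if "u \<in> A" "v \<in> A" "u \<noteq> v" for u v
        using x bound[OF that] that by (fastforce simp: center_diff)
      then have "center A x \<in> ?P + ?Q"
        unfolding a by (simp add: center_in_sum_zero_space)
      then obtain y z where y: "y \<in> ?P" and z: "z \<in> ?Q" and yz: "center A x = y + z"
        by (rule set_plus_elim)
      \<comment> \<open>\<open>center\<close> has subtracted the mean \<open>c\<close>; it is given
        back to \<open>y\<close>, whose differences do not change.\<close>
      define c where "c = (\<Sum>v\<in>A. x v) / real (card A)"
      show "\<exists>y z. (\<forall>u\<in>A. x u = y u + z u) \<and>
          (\<forall>u\<in>A. \<forall>v\<in>A. y u - y v \<le> inversion_cost p u v \<and> z u - z v \<le> inversion_cost q u v)"
      proof (rule exI[of _ "\<lambda>u. y $ u + c"], rule exI[of _ "\<lambda>u. z $ u"], intro conjI ballI)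
        fix u assume "u \<in> A"
        then have "x u - c = (y + z) $ u"
          unfolding yz[symmetric] by (simp add: center_def c_def)
        then show "x u = y $ u + c + z $ u"
          by simp
      qed (use y z P Q in auto)
    qed
  next
    assume spl: "splits A (inversion_cost p) (inversion_cost q)"
    have sum: "?P + ?Q = {x \<in> sum_zero_space A. \<forall>i\<in>A. \<forall>j\<in>A. i \<noteq> j \<longrightarrow>
        x $ i - x $ j \<le> inversion_cost p i j + inversion_cost q i j}" (is "_ = ?R")
    proof
      show "?P + ?Q \<subseteq> ?R"
      proof
        fix x assume "x \<in> ?P + ?Q"
        then obtain y z where y: "y \<in> ?P" and z: "z \<in> ?Q" and x: "x = y + z"
          by (rule set_plus_elim)
        have "x $ u - x $ v \<le> inversion_cost p u v + inversion_cost q u v" if "u \<in> A" "v \<in> A" for u v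
        proof -
          have "y $ u - y $ v \<le> inversion_cost p u v" "z $ u - z $ v \<le> inversion_cost q u v"
            using y z P Q that by blast+
          then show ?thesis
            by (simp add: x)
        qed
        moreover have "x \<in> sum_zero_space A"
          unfolding x using y z P Q subspace_add[OF subspace_sum_zero_space] by blast
        ultimately show "x \<in> ?R"
          by blast
      qed
      show "?R \<subseteq> ?P + ?Q"
      proof
        fix x assume x: "x \<in> ?R"
        have "x $ u - x $ v \<le> inversion_cost p u v + inversion_cost q u v" if "u \<in> A" "v \<in> A" for u v
          using x that by (cases "u = v") (auto simp: inversion_cost_def)
        then obtain y z where yz: "\<And>u. u \<in> A \<Longrightarrow> x $ u = y u + z u"
          "\<And>u v. u \<in> A \<Longrightarrow> v \<in> A \<Longrightarrow> y u - y v \<le> inversion_cost p u v \<and> z u - z v \<le> inversion_cost q u v"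
          using spl[unfolded splits_def, THEN spec, of "\<lambda>u. x $ u"] by blast
        have "x = center A y + center A z"
          using x yz(1) by (intro sum_zero_space_center) auto
        moreover have "center A y \<in> ?P" "center A z \<in> ?Q"
          using yz(2) by (simp_all add: P Q center_in_sum_zero_space center_diff)
        ultimately show "x \<in> ?P + ?Q"
          by (simp add: set_plus_intro)
      qed
    qed
    have "polytope (?P + ?Q)"
      using ordered_set_partition_singletons(1) list_positions.dist[OF xs] list_positions.dist[OF ys] eq
      by (metis polytope_set_plus polytope_alcoved_simplex)
    then show "compatible A (singletons xs) (singletons ys)"
      unfolding compatible_def alcoved_def using sum by (intro conjI exI)
  qed
qed

text \<open>Holds for an arbitrary ground set \<open>A\<close>, since the criterion on small subsets
  applies it to every restriction.\<close>

lemma not_compatible_iff_interlaced: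
  fixes S T :: "'n::finite set list"
  assumes S: "ordered_set_partition A S" "nondegenerate S"
    and T: "ordered_set_partition A T" "nondegenerate T"
  shows "\<not> compatible A S T \<longleftrightarrow> four_interlaced S T \<or> six_interlaced S T"
proof -
  obtain xs where xs: "distinct xs" "set xs = A" "S = singletons xs"
    using nondegenerate_imp_singletons[OF S] .
  obtain ys where ys: "distinct ys" "set ys = A" "T = singletons ys"
    using nondegenerate_imp_singletons[OF T] .
  obtain p where p: "list_positions xs p"
    using list_positions_exists[OF xs(1)] .
  obtain q where q: "list_positions ys q"
    using list_positions_exists[OF ys(1)] .
  have inj: "inj_on p A" "inj_on q A"
    using list_positions.inj_on_pos[OF p] list_positions.inj_on_pos[OF q] xs ys by auto
  show ?thesis
    unfolding xs(3) ys(3) compatible_singletons_iff_splits[OF p q xs(2) ys(2)]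
      four_interlaced_iff[OF p q xs(2) ys(2)] six_interlaced_iff[OF p q xs(2) ys(2)]
  proof (rule iffI, goal_cases)
    case 1
    then show ?case
      by (rule not_splits_imp_interlaced[OF finite inj])
  next
    case 2
    then show ?case
    proof (rule disjE, goal_cases)
      case 1
      then show ?case
        by (elim bexE conjE) (rule four_interlaced_imp_not_splits[OF finite])
    next
      case 2
      then show ?case
        by (elim bexE conjE) (rule six_interlaced_imp_not_splits[OF finite])
    qed
  qed
qed

section \<open>Restriction to subsets\<close>

lemma osp_restrict_nondegenerate:
  assumes "ordered_set_partition UNIV S" "nondegenerate S"
  shows "ordered_set_partition I (osp_restrict S I)" "nondegenerate (osp_restrict S I)"
proof -
  obtain xs where xs: "distinct xs" "set xs = UNIV" "S = singletons xs"
    using nondegenerate_imp_singletons[OF assms] .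
  have "set (filter (\<lambda>x. x \<in> I) xs) = I"
    using xs(2) by auto
  then show "ordered_set_partition I (osp_restrict S I)" "nondegenerate (osp_restrict S I)"
    using ordered_set_partition_singletons[of "filter (\<lambda>x. x \<in> I) xs"] xs
    by (simp_all add: osp_restrict_singletons)
qed

lemma osp_restrict_restrict: "osp_restrict (osp_restrict S I) J = osp_restrict S (I \<inter> J)"
  by (induction S) (auto simp: osp_restrict_def Int_assoc)

text \<open>The blocks \<open>Bs\<close> cover \<open>J\<close>, so \<open>J\<close> lies inside
  \<open>I\<close> and the intermediate restriction deletes nothing of it.\<close>

lemma cyclic_eq_restrict_restrictD:
  assumes "ordered_set_partition UNIV S" "nondegenerate S"
    and eq: "cyclic_eq (osp_restrict (osp_restrict S I) J) Bs" and J: "\<Union> (set Bs) = J"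
  shows "cyclic_eq (osp_restrict S J) Bs"
proof -
  have "\<Union> (set (osp_restrict S (I \<inter> J))) = I \<inter> J"
    using osp_restrict_nondegenerate(1)[OF assms(1,2), of "I \<inter> J"]
    by (simp add: ordered_set_partition_def)
  moreover have "set (osp_restrict S (I \<inter> J)) = set Bs"
    using eq unfolding osp_restrict_restrict cyclic_eq_def by (metis set_rotate)
  ultimately have "I \<inter> J = J"
    using J by simp
  then show ?thesis
    using eq by (simp add: osp_restrict_restrict)
qed

text \<open>For one direction, \<open>I\<close> is the set of the four or six witnesses. For the
  other, the witnesses found inside \<open>I\<close> serve for the full orders as well.\<close>

lemma interlaced_iff_restrict:
  fixes S T :: "'n::finite set list"
  assumes S: "ordered_set_partition UNIV S" "nondegenerate S"
    and T: "ordered_set_partition UNIV T" "nondegenerate T"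
  shows "four_interlaced S T \<or> six_interlaced S T \<longleftrightarrow>
    (\<exists>I. card I \<le> 6 \<and> (four_interlaced (osp_restrict S I) (osp_restrict T I) \<or>
       six_interlaced (osp_restrict S I) (osp_restrict T I)))"
    (is "?L \<longleftrightarrow> (\<exists>I. ?R I)")
proof
  assume ?L
  then show "\<exists>I. ?R I"
  proof
    assume "four_interlaced S T"
    then obtain a b c d where *: "distinct [a, b, c, d]"
      "cyclic_eq (osp_restrict S {a, b, c, d}) [{a}, {b}, {c}, {d}]"
      "cyclic_eq (osp_restrict T {a, b, c, d}) [{c}, {b}, {a}, {d}]"
      unfolding four_interlaced_def by (elim exE conjE) (rule that)
    have "four_interlaced (osp_restrict S {a, b, c, d}) (osp_restrict T {a, b, c, d})"
      unfolding four_interlaced_def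
      by (intro exI[of _ a] exI[of _ b] exI[of _ c] exI[of _ d])
        (use * in \<open>simp add: osp_restrict_restrict\<close>)
    moreover have "card {a, b, c, d} \<le> 6"
      using card_length[of "[a, b, c, d]"] by simp
    ultimately show ?thesis
      by blast
  next
    assume "six_interlaced S T"
    then obtain a b c d e f where *: "distinct [a, b, c, d, e, f]"
      "cyclic_eq (osp_restrict S {a, b, c, d, e, f}) [{a}, {b}, {c}, {d}, {e}, {f}]"
      "cyclic_eq (osp_restrict T {a, b, c, d, e, f}) [{c}, {d}, {a}, {b}, {e}, {f}] \<or>
       cyclic_eq (osp_restrict T {a, b, c, d, e, f}) [{a}, {d}, {e}, {b}, {c}, {f}]"
      unfolding six_interlaced_def by (elim exE conjE) (rule that)
    have "six_interlaced (osp_restrict S {a, b, c, d, e, f}) (osp_restrict T {a, b, c, d, e, f})"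
      unfolding six_interlaced_def
      by (intro exI[of _ a] exI[of _ b] exI[of _ c] exI[of _ d] exI[of _ e] exI[of _ f])
        (use * in \<open>simp add: osp_restrict_restrict\<close>)
    moreover have "card {a, b, c, d, e, f} \<le> 6"
      using card_length[of "[a, b, c, d, e, f]"] by simp
    ultimately show ?thesis
      by blast
  qed
next
  assume "\<exists>I. ?R I"
  then obtain I where IL: "four_interlaced (osp_restrict S I) (osp_restrict T I) \<or>
       six_interlaced (osp_restrict S I) (osp_restrict T I)"
    by blast
  have four: "four_interlaced S T" if I: "four_interlaced (osp_restrict S I) (osp_restrict T I)"
  proof -
    obtain a b c d where "distinct [a, b, c, d]"
      "cyclic_eq (osp_restrict (osp_restrict S I) {a, b, c, d}) [{a}, {b}, {c}, {d}]"
      "cyclic_eq (osp_restrict (osp_restrict T I) {a, b, c, d}) [{c}, {b}, {a}, {d}]"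
      using I unfolding four_interlaced_def by (elim exE conjE) (rule that)
    then have "distinct [a, b, c, d]"
      "cyclic_eq (osp_restrict S {a, b, c, d}) [{a}, {b}, {c}, {d}]"
      "cyclic_eq (osp_restrict T {a, b, c, d}) [{c}, {b}, {a}, {d}]"
      using cyclic_eq_restrict_restrictD[OF S, of I "{a, b, c, d}"]
        cyclic_eq_restrict_restrictD[OF T, of I "{a, b, c, d}"] by fastforce+
    then show ?thesis
      unfolding four_interlaced_def by (intro exI conjI)
  qed
  have six: "six_interlaced S T" if I: "six_interlaced (osp_restrict S I) (osp_restrict T I)"
  proof -
    obtain a b c d e f where "distinct [a, b, c, d, e, f]"
      "cyclic_eq (osp_restrict (osp_restrict S I) {a, b, c, d, e, f}) [{a}, {b}, {c}, {d}, {e}, {f}]"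
      "cyclic_eq (osp_restrict (osp_restrict T I) {a, b, c, d, e, f}) [{c}, {d}, {a}, {b}, {e}, {f}] \<or>
       cyclic_eq (osp_restrict (osp_restrict T I) {a, b, c, d, e, f}) [{a}, {d}, {e}, {b}, {c}, {f}]"
      using I unfolding six_interlaced_def by (elim exE conjE) (rule that)
    then have "distinct [a, b, c, d, e, f]"
      "cyclic_eq (osp_restrict S {a, b, c, d, e, f}) [{a}, {b}, {c}, {d}, {e}, {f}]"
      "cyclic_eq (osp_restrict T {a, b, c, d, e, f}) [{c}, {d}, {a}, {b}, {e}, {f}] \<or>
       cyclic_eq (osp_restrict T {a, b, c, d, e, f}) [{a}, {d}, {e}, {b}, {c}, {f}]"
      using cyclic_eq_restrict_restrictD[OF S, of I "{a, b, c, d, e, f}"]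
        cyclic_eq_restrict_restrictD[OF T, of I "{a, b, c, d, e, f}"] by fastforce+
    then show ?thesis
      unfolding six_interlaced_def by (intro exI conjI)
  qed
  show ?L
    using IL four six by (rule disj_forward)
qed

theorem theorem5p5:
  fixes S T :: "'n::finite set list"
  assumes "ordered_set_partition UNIV S" "nondegenerate S"
    and "ordered_set_partition UNIV T" "nondegenerate T"
  shows "(\<not> compatible UNIV S T \<longleftrightarrow> four_interlaced S T \<or> six_interlaced S T) \<and>
    (compatible UNIV S T \<longleftrightarrow>
      (\<forall>I :: 'n set. card I \<le> 6 \<longrightarrow> compatible I (osp_restrict S I) (osp_restrict T I)))"
proof -
  note main = not_compatible_iff_interlaced[OF assms]
  have "\<not> compatible I (osp_restrict S I) (osp_restrict T I) \<longleftrightarrow>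
      four_interlaced (osp_restrict S I) (osp_restrict T I) \<or>
      six_interlaced (osp_restrict S I) (osp_restrict T I)" for I
    by (intro not_compatible_iff_interlaced osp_restrict_nondegenerate assms)
  then show ?thesis
    using main interlaced_iff_restrict[OF assms] by blast
qed

end
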